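(* Let $T>0$ and let $\alpha\in L^\infty(0,\pi)$ be defined by $$\alpha(x):=\sum_{j=1}^{\infty}\frac{1}{j^2}\cos(15jx)\quad\text{for all }x\in(0,\pi).$$ Consider the boundary control system $$\begin{cases}\partial_t y=\Delta y+\alpha z&\text{in }(0,\pi)\times(0,T),\\ \partial_t z=\Delta z&\text{in }(0,\pi)\times(0,T),\\ y(0,t)=v(t),\ y(\pi,t)=z(0,t)=z(\pi,t)=0&\text{on }(0,T),\\ y(x,0)=y_0(x),\ z(x,0)=z_0(x)&\text{in }(0,\pi).\end{cases}$$ Then there exists $k_1\in\{1,\dots,7\}$ such that for $(y_0,z_0):=(0,w_{k_1})$ and all controls $v\in L^2(0,T)$, the solution to this system satisfies $y(T)\not\equiv0$ in $(0,\pi)$.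
   Context: $(w_k)_{k\ge1}$ are the $L^2$-normalized eigenfunctions of $-\Delta$ in $(0,\pi)$ with Dirichlet boundary conditions, associated with the eigenvalues $k^2$ (so $w_k(x)=\sqrt{2/\pi}\,\sin(kx)$ up to sign). For $y_0,z_0\in H^{-1}(0,\pi)$ and $v\in L^2(0,T)$ the system has a unique solution $(y,z)\in L^2(Q_T)^2\cap\mathcal{C}^0([0,T];H^{-1}(0,\pi)^2)$, $Q_T=(0,\pi)\times(0,T)$, defined by transposition: for all $g_1,g_2\in L^2(Q_T)$, $$\iint_{Q_T}(y g_1+z g_2)\,dx\,dt=\langle y_0,\phi(\cdot,0)\rangle_{H^{-1},H^1_0}+\langle z_0,\psi(\cdot,0)\rangle_{H^{-1},H^1_0}+\int_0^Tv(t)\,\phi_x(0,t)\,dt,$$ where $(\phi,\psi)$ solves $-\partial_t\phi=\Delta\phi+g_1$, $-\partial_t\psi=\Delta\psi+\alpha\phi+g_2$ in $Q_T$ with homogeneous Dirichlet boundary conditions and $\phi(T)=\psi(T)=0$. *)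

theory Defs
  imports "HOL-Analysis.Analysis"
begin

text \<open>All integrals are taken with respect to the complete measure \<^const>\<open>lebesgue\<close>, so that a
  function which is only determined almost everywhere may be changed on a null set without
  affecting measurability or its integral.\<close>

definition L2 :: "'a::euclidean_space set \<Rightarrow> ('a \<Rightarrow> real) set" where
  "L2 \<Omega> = {f. set_borel_measurable lebesgue \<Omega> f \<and> set_integrable lebesgue \<Omega> (\<lambda>x. (f x)\<^sup>2)}"

definition L2_norm :: "'a::euclidean_space set \<Rightarrow> ('a \<Rightarrow> real) \<Rightarrow> real" where
  "L2_norm \<Omega> f = sqrt (LINT x:\<Omega>|lebesgue. (f x)\<^sup>2)"

text \<open>Test functions of class \<open>C\<^sup>1\<close> with compact support in \<open>\<Omega>\<close>; the second function is the total
  derivative of the first. For functions in \<open>L\<^sup>2\<close>, testing with \<open>C\<^sup>1\<close> or with smooth functions gives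
  the same weak derivatives, by mollification.\<close>

definition test_function ::
  "'a::euclidean_space set \<Rightarrow> ('a \<Rightarrow> real) \<Rightarrow> ('a \<Rightarrow> 'a \<Rightarrow> real) \<Rightarrow> bool" where
  "test_function \<Omega> \<eta> D\<eta> \<longleftrightarrow>
     (\<forall>x. (\<eta> has_derivative D\<eta> x) (at x)) \<and>
     (\<forall>b. continuous_on UNIV (\<lambda>x. D\<eta> x b)) \<and>
     (\<exists>K. compact K \<and> K \<subseteq> \<Omega> \<and> (\<forall>x. x \<notin> K \<longrightarrow> \<eta> x = 0))"

definition weak_deriv ::
  "'a::euclidean_space set \<Rightarrow> 'a \<Rightarrow> ('a \<Rightarrow> real) \<Rightarrow> ('a \<Rightarrow> real) \<Rightarrow> bool" where
  "weak_deriv \<Omega> b f g \<longleftrightarrow>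
     (\<forall>\<eta> D\<eta>. test_function \<Omega> \<eta> D\<eta> \<longrightarrow>
        (LINT x:\<Omega>|lebesgue. f x * D\<eta> x b) = - (LINT x:\<Omega>|lebesgue. g x * \<eta> x))"

text \<open>Elements of \<open>H\<^sup>1\<^sub>0(0,\<pi>)\<close> are represented by their continuous representatives on \<open>[0,\<pi>]\<close>,
  whose endpoint values are the traces. Values outside \<open>[0,\<pi>]\<close> are irrelevant.\<close>

definition H10 :: "(real \<Rightarrow> real) set" where
  "H10 = {u. continuous_on {0..pi} u \<and> u 0 = 0 \<and> u pi = 0 \<and>
             (\<exists>g\<in>L2 {0<..<pi}. weak_deriv {0<..<pi} 1 u g)}"

text \<open>The closed unit ball of \<open>H\<^sup>1\<^sub>0(0,\<pi>)\<close> for the norm \<open>\<parallel>u\<^sub>x\<parallel>\<close> of \<open>L\<^sup>2(0,\<pi>)\<close>.\<close>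

definition H10_unit_ball :: "(real \<Rightarrow> real) set" where
  "H10_unit_ball = {u \<in> H10. \<exists>g\<in>L2 {0<..<pi}. weak_deriv {0<..<pi} 1 u g \<and> L2_norm {0<..<pi} g \<le> 1}"

text \<open>\<open>H\<^sup>-\<^sup>1(0,\<pi>)\<close> is the topological dual of \<open>H\<^sup>1\<^sub>0(0,\<pi>)\<close>; the duality pairing \<open>\<langle>l, u\<rangle>\<close> is \<open>l u\<close>, and
  only the values of \<open>l\<close> on \<^term>\<open>H10\<close> matter.\<close>

definition Hm1 :: "((real \<Rightarrow> real) \<Rightarrow> real) set" where
  "Hm1 = {l. (\<forall>u\<in>H10. \<forall>v\<in>H10. l (\<lambda>x. u x + v x) = l u + l v) \<and>
             (\<forall>c. \<forall>u\<in>H10. l (\<lambda>x. c * u x) = c * l u) \<and>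
             (\<exists>C. \<forall>u\<in>H10_unit_ball. \<bar>l u\<bar> \<le> C)}"

definition Hm1_norm :: "((real \<Rightarrow> real) \<Rightarrow> real) \<Rightarrow> real" where
  "Hm1_norm l = (SUP u\<in>H10_unit_ball. \<bar>l u\<bar>)"

text \<open>The embedding of \<open>L\<^sup>2(0,\<pi>)\<close> into \<open>H\<^sup>-\<^sup>1(0,\<pi>)\<close>.\<close>

definition Hm1_of :: "(real \<Rightarrow> real) \<Rightarrow> (real \<Rightarrow> real) \<Rightarrow> real" where
  "Hm1_of f u = (LINT x:{0<..<pi}|lebesgue. f x * u x)"

definition QT :: "real \<Rightarrow> (real \<times> real) set" where
  "QT T = {0<..<pi} \<times> {0<..<T}"

text \<open>\<open>y \<in> L\<^sup>2(Q\<^sub>T) \<inter> C\<^sup>0([0,T]; H\<^sup>-\<^sup>1(0,\<pi>))\<close>, where \<open>Y\<close> is the continuous \<open>H\<^sup>-\<^sup>1\<close>-valued function that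
  agrees with \<open>t \<mapsto> y(\<cdot>,t)\<close> for almost every \<open>t\<close>.\<close>

definition L2_C0_Hm1 ::
  "real \<Rightarrow> (real \<times> real \<Rightarrow> real) \<Rightarrow> (real \<Rightarrow> (real \<Rightarrow> real) \<Rightarrow> real) \<Rightarrow> bool" where
  "L2_C0_Hm1 T y Y \<longleftrightarrow>
     y \<in> L2 (QT T) \<and>
     (\<forall>t\<in>{0..T}. Y t \<in> Hm1) \<and>
     (\<forall>t\<in>{0..T}. ((\<lambda>s. Hm1_norm (\<lambda>u. Y s u - Y t u)) \<longlongrightarrow> 0) (at t within {0..T})) \<and>
     (AE t in lebesgue. t \<in> {0<..<T} \<longrightarrow> (\<forall>u\<in>H10. Y t u = Hm1_of (\<lambda>x. y (x, t)) u))"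

text \<open>Strong solutions, in \<open>L\<^sup>2(0,T; H\<^sup>2 \<inter> H\<^sup>1\<^sub>0) \<inter> H\<^sup>1(0,T; L\<^sup>2)\<close>, of the backward heat equation
  \<open>-\<partial>\<^sub>t\<phi> = \<phi>\<^sub>x\<^sub>x + h\<close> in \<open>Q\<^sub>T\<close> with homogeneous Dirichlet conditions and \<open>\<phi>(T) = 0\<close>. This space embeds
  into the continuous functions on the closure of \<open>Q\<^sub>T\<close>, and \<open>\<phi>\<close> denotes the continuous
  representative, so that the boundary and terminal conditions are pointwise.\<close>

definition backward_heat_solution ::
  "real \<Rightarrow> (real \<times> real \<Rightarrow> real) \<Rightarrow> (real \<times> real \<Rightarrow> real) \<Rightarrow> bool" where
  "backward_heat_solution T h \<phi> \<longleftrightarrow>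
     continuous_on ({0..pi} \<times> {0..T}) \<phi> \<and>
     (\<forall>t\<in>{0..T}. \<phi> (0, t) = 0 \<and> \<phi> (pi, t) = 0) \<and>
     (\<forall>x\<in>{0..pi}. \<phi> (x, T) = 0) \<and>
     (\<exists>\<phi>\<^sub>t \<phi>\<^sub>x \<phi>\<^sub>x\<^sub>x. \<phi>\<^sub>t \<in> L2 (QT T) \<and> \<phi>\<^sub>x \<in> L2 (QT T) \<and> \<phi>\<^sub>x\<^sub>x \<in> L2 (QT T) \<and>
        weak_deriv (QT T) (0, 1) \<phi> \<phi>\<^sub>t \<and>
        weak_deriv (QT T) (1, 0) \<phi> \<phi>\<^sub>x \<and>
        weak_deriv (QT T) (1, 0) \<phi>\<^sub>x \<phi>\<^sub>x\<^sub>x \<and>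
        (AE p in lebesgue. p \<in> QT T \<longrightarrow> - \<phi>\<^sub>t p = \<phi>\<^sub>x\<^sub>x p + h p))"

definition adjoint_solution ::
  "real \<Rightarrow> (real \<Rightarrow> real) \<Rightarrow> (real \<times> real \<Rightarrow> real) \<Rightarrow> (real \<times> real \<Rightarrow> real) \<Rightarrow>
   (real \<times> real \<Rightarrow> real) \<Rightarrow> (real \<times> real \<Rightarrow> real) \<Rightarrow> bool" where
  "adjoint_solution T \<alpha> g1 g2 \<phi> \<psi> \<longleftrightarrow>
     backward_heat_solution T g1 \<phi> \<and>
     backward_heat_solution T (\<lambda>(x, t). \<alpha> x * \<phi> (x, t) + g2 (x, t)) \<psi>"

text \<open>The boundary derivative \<open>\<phi>\<^sub>x(0,t)\<close>. For a strong solution \<open>\<phi>\<close> and almost every \<open>t\<close>, the function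
  \<open>\<phi>(\<cdot>,t)\<close> lies in \<open>H\<^sup>2(0,\<pi>)\<close>, hence in \<open>C\<^sup>1([0,\<pi>])\<close>, so this one-sided derivative exists.\<close>

definition dx_at_0 :: "(real \<times> real \<Rightarrow> real) \<Rightarrow> real \<Rightarrow> real" where
  "dx_at_0 \<phi> t = vector_derivative (\<lambda>x. \<phi> (x, t)) (at_right 0)"

text \<open>Solution by transposition of
  \<open>\<partial>\<^sub>t y = y\<^sub>x\<^sub>x + \<alpha> z\<close>, \<open>\<partial>\<^sub>t z = z\<^sub>x\<^sub>x\<close> in \<open>Q\<^sub>T\<close>,
  \<open>y(0,t) = v(t)\<close>, \<open>y(\<pi>,t) = z(0,t) = z(\<pi>,t) = 0\<close>,
  \<open>y(\<cdot>,0) = y\<^sub>0\<close>, \<open>z(\<cdot>,0) = z\<^sub>0\<close> in \<open>H\<^sup>-\<^sup>1(0,\<pi>)\<close>.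
  \<open>Y\<close> and \<open>Z\<close> are the continuous \<open>H\<^sup>-\<^sup>1\<close>-valued versions of \<open>y\<close> and \<open>z\<close>.\<close>

definition transposition_solution ::
  "real \<Rightarrow> (real \<Rightarrow> real) \<Rightarrow> ((real \<Rightarrow> real) \<Rightarrow> real) \<Rightarrow> ((real \<Rightarrow> real) \<Rightarrow> real) \<Rightarrow> (real \<Rightarrow> real) \<Rightarrow>
   (real \<times> real \<Rightarrow> real) \<Rightarrow> (real \<times> real \<Rightarrow> real) \<Rightarrow>
   (real \<Rightarrow> (real \<Rightarrow> real) \<Rightarrow> real) \<Rightarrow> (real \<Rightarrow> (real \<Rightarrow> real) \<Rightarrow> real) \<Rightarrow> bool" where
  "transposition_solution T \<alpha> y0 z0 v y z Y Z \<longleftrightarrow>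
     L2_C0_Hm1 T y Y \<and> L2_C0_Hm1 T z Z \<and>
     (\<forall>g1\<in>L2 (QT T). \<forall>g2\<in>L2 (QT T). \<forall>\<phi> \<psi>. adjoint_solution T \<alpha> g1 g2 \<phi> \<psi> \<longrightarrow>
        (LINT p:QT T|lebesgue. y p * g1 p + z p * g2 p) =
          y0 (\<lambda>x. \<phi> (x, 0)) + z0 (\<lambda>x. \<psi> (x, 0)) +
          (LINT t:{0<..<T}|lebesgue. v t * dx_at_0 \<phi> t))"

definition normalized_dirichlet_eigenfunction :: "real \<Rightarrow> (real \<Rightarrow> real) \<Rightarrow> bool" where
  "normalized_dirichlet_eigenfunction \<mu> w \<longleftrightarrow>
     continuous_on {0..pi} w \<and> w 0 = 0 \<and> w pi = 0 \<and>
     (\<exists>w'. \<forall>x\<in>{0<..<pi}. (w has_real_derivative w' x) (at x) \<and>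
                         (w' has_real_derivative - \<mu> * w x) (at x)) \<and>
     L2_norm {0<..<pi} w = 1"

end

theory Submission imports Defs begin

text \<open>
  Already the first eigenfunction, a multiple of \<open>sin x\<close>, cannot be steered to \<open>y(T) = 0\<close>. The component
  \<open>z\<close> evolves freely and stays a multiple of \<open>exp (- t) sin x\<close>. Multiplication by \<open>cos (15 j x)\<close>
  links mode 1 only to the modes \<open>15 j + 1\<close> and \<open>15 j - 1\<close>. Taking the \<open>l\<close>-th sine coefficient of the
  equation for \<open>y\<close>, the condition \<open>y(T) = 0\<close> therefore prescribes the moments
  \<open>M(l\<^sup>2) = \<integral>\<^sub>0\<^sup>T v(t) exp (- l\<^sup>2 (T - t)) dt\<close> of the control (\<open>moment_identity_if_null_at_T\<close> and
  \<open>coupling_integral_eq\<close>): \<open>M(l\<^sup>2) = 0\<close> whenever 15 divides \<open>l\<close>, whereas for \<open>l = 30 n + 1\<close> the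
  modulus of \<open>M(l\<^sup>2)\<close> is at least a positive constant times \<open>n\<close> to the power -5.

  These requirements contradict each other. As a function of a complex variable, \<open>M\<close> is bounded and
  holomorphic in the right half-plane, and so many zeros force it to be exponentially small between
  them, by comparison with a Blaschke product. A finite form of this is enough: the functions
  \<open>exp (- a u)\<close> with \<open>a\<close> in a finite set \<open>S\<close> of positive numbers have a linear combination whose
  \<open>L\<^sup>2(0,\<infinity>)\<close> distance to \<open>exp (- b u)\<close> is the product of \<open>\<bar>b - a\<bar> / (b + a)\<close> over \<open>S\<close>, divided by
  \<open>sqrt (2 b)\<close>. Its coefficients are the residues of a rational function, so the proof is a partial
  fraction computation (\<open>moment_bound_by_vanishing_moments\<close>). With \<open>b = (30 n + 1)\<^sup>2\<close> and \<open>S\<close> the squares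
  of the \<open>n\<close> largest multiples of 15 below \<open>30 n + 1\<close>, every factor is at most 3/5, whence
  \<open>M(b)\<close> is of order \<open>(3/5) ^ n\<close> (\<open>moments_decay_geometrically\<close>), which for large \<open>n\<close> is below
  the required power of \<open>n\<close>.

  The moments are extracted from the definition by transposition with separated test functions
  \<open>\<theta>(t) sin (l x)\<close>, and the value at \<open>T\<close> is reached through the continuity of \<open>y\<close> with values in
  \<open>H\<^sup>-\<^sup>1\<close> (\<open>terminal_concentration\<close>).
\<close>

section \<open>Integration with respect to Lebesgue measure\<close>

lemma set_integrable_continuous:
  fixes f :: "'a::euclidean_space \<Rightarrow> real"
  assumes "continuous_on UNIV f" "bounded \<Omega>" "open \<Omega>"
  shows "set_integrable lebesgue \<Omega> f"
proof -
  have "integrable lborel (\<lambda>x. indicator (closure \<Omega>) x *\<^sub>R f x)"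
    using assms by (intro borel_integrable_compact)
      (auto intro: continuous_on_subset)
  then have "set_integrable lebesgue (closure \<Omega>) f"
    unfolding set_integrable_def
    by (subst integrable_completion) (auto dest: borel_measurable_integrable)
  then show ?thesis
    by (rule set_integrable_subset) (use assms closure_subset in auto)
qed

lemma continuous_in_L2:
  fixes f :: "'a::euclidean_space \<Rightarrow> real"
  assumes "continuous_on UNIV f" "bounded \<Omega>" "open \<Omega>"
  shows "f \<in> L2 \<Omega>"
proof -
  have "set_integrable lebesgue \<Omega> (\<lambda>x. (f x)\<^sup>2)"
    using assms by (intro set_integrable_continuous) (auto intro: continuous_intros)
  moreover have "set_borel_measurable lebesgue \<Omega> f"
    using set_integrable_continuous[OF assms]
    by (auto simp: set_integrable_def set_borel_measurable_def dest: borel_measurable_integrable)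
  ultimately show ?thesis by (simp add: L2_def)
qed

lemma L2_times_continuous_integrable:
  fixes f g :: "'a::euclidean_space \<Rightarrow> real"
  assumes "f \<in> L2 \<Omega>" "continuous_on UNIV g" "bounded \<Omega>" "open \<Omega>"
  shows "set_integrable lebesgue \<Omega> (\<lambda>x. f x * g x)"
proof (rule set_integrable_bound)
  have "set_integrable lebesgue \<Omega> (\<lambda>x. (f x)\<^sup>2)" "set_integrable lebesgue \<Omega> (\<lambda>x. (g x)\<^sup>2)"
    using assms continuous_in_L2[OF assms(2-4)] by (auto simp: L2_def)
  then show "set_integrable lebesgue \<Omega> (\<lambda>x. (f x)\<^sup>2 + (g x)\<^sup>2)"
    by (rule set_integral_add)
  have "(\<lambda>x. (indicat_real \<Omega> x *\<^sub>R f x) * (indicat_real \<Omega> x *\<^sub>R g x)) \<in> borel_measurable lebesgue"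
    using assms continuous_in_L2[OF assms(2-4)]
    by (intro borel_measurable_times) (auto simp: L2_def set_borel_measurable_def)
  then show "set_borel_measurable lebesgue \<Omega> (\<lambda>x. f x * g x)"
    unfolding set_borel_measurable_def by (rule measurable_cong[THEN iffD1, rotated]) (auto simp: indicator_def)
  have "\<bar>f x * g x\<bar> \<le> (f x)\<^sup>2 + (g x)\<^sup>2" for x
  proof -
    have "2 * (\<bar>f x\<bar> * \<bar>g x\<bar>) \<le> (f x)\<^sup>2 + (g x)\<^sup>2"
      using sum_squares_bound[of "\<bar>f x\<bar>" "\<bar>g x\<bar>"] by (simp add: mult.assoc)
    moreover have "0 \<le> \<bar>f x\<bar> * \<bar>g x\<bar>" by simp
    ultimately show ?thesis unfolding abs_mult by linarith
  qed
  then show "AE x in lebesgue. x \<in> \<Omega> \<longrightarrow> norm (f x * g x) \<le> norm ((f x)\<^sup>2 + (g x)\<^sup>2)"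
    by (auto simp: abs_of_nonneg)
qed

text \<open>The Fubini theorem for products of measures speaks of Borel functions only, and the sections of a
  Lebesgue measurable function need not be measurable. A Borel function that agrees with \<open>f\<close> almost
  everywhere agrees with it almost everywhere on almost every section.\<close>

lemma lebesgue_Fubini_snd:
  fixes f :: "real \<times> real \<Rightarrow> real"
  assumes "integrable lebesgue f"
  shows "integrable lebesgue (\<lambda>t. LINT x|lebesgue. f (x, t))"
    and "(LINT p|lebesgue. f p) = (LINT t|lebesgue. LINT x|lebesgue. f (x, t))"
proof -
  obtain g where g [measurable]: "g \<in> borel_measurable lborel" and fg: "AE p in lborel. f p = g p"
    using completion_ex_borel_measurable_real[OF borel_measurable_integrable[OF assms]] by auto
  have fg': "AE p in lebesgue. f p = g p" by (rule AE_completion[OF fg])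
  have gl: "g \<in> borel_measurable lebesgue" using g by (rule measurable_completion)
  have gi: "integrable lborel g"
    using assms integrable_cong_AE[OF borel_measurable_integrable[OF assms] gl fg']
    integrable_completion[OF g] by blast
  then have gi2: "integrable (lborel \<Otimes>\<^sub>M lborel) (case_prod (\<lambda>x t. g (x, t)))"
    by (simp add: lborel_prod)
  obtain N where N: "N \<in> null_sets lborel" "{p. f p \<noteq> g p} \<subseteq> N"
    using fg unfolding eventually_ae_filter by auto
  have "AE p in lborel \<Otimes>\<^sub>M lborel. p \<notin> N"
    using N(1) by (simp add: lborel_prod AE_not_in)
  then have "AE x in lborel. AE t in lborel. (x, t) \<notin> N"
    by (rule lborel_pair.AE_pair)
  moreover have "{x \<in> space (lborel \<Otimes>\<^sub>M lborel). (fst x, snd x) \<notin> N} \<in> sets (lborel \<Otimes>\<^sub>M lborel)"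
  proof -
    have "- N \<in> sets (lborel \<Otimes>\<^sub>M lborel)"
      using null_setsD2[OF N(1)] unfolding lborel_prod by (auto intro: sets.compl_sets)
    then show ?thesis by (simp add: space_pair_measure flip: Compl_eq)
  qed
  ultimately have "AE t in lborel. AE x in lborel. (x, t) \<notin> N"
    by (subst (asm) lborel_pair.AE_commute) auto
  then have "AE t in lborel. AE x in lborel. f (x, t) = g (x, t)"
  proof (rule eventually_mono)
    fix t assume "AE x in lborel. (x, t) \<notin> N"
    then show "AE x in lborel. f (x, t) = g (x, t)"
      by (rule eventually_mono) (use N(2) in auto)
  qed
  moreover have "(LINT x|lebesgue. f (x, t)) = (LINT x|lborel. g (x, t))" 
    if t: "AE x in lborel. f (x, t) = g (x, t)" for t
  proof -
    have m: "(\<lambda>x. g (x, t)) \<in> borel_measurable lborel" by measurable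
    have t': "AE x in lebesgue. g (x, t) = f (x, t)" 
      using AE_completion[OF t] by eventually_elim simp
    have ml: "(\<lambda>x. g (x, t)) \<in> borel_measurable lebesgue" using m by (rule measurable_completion)
    have "(\<lambda>x. f (x, t)) \<in> borel_measurable lebesgue"
      by (rule borel_measurable_AE[OF ml t'])
    with t' ml show ?thesis
      by (subst integral_completion[OF m, symmetric], intro integral_cong_AE) auto
  qed
  ultimately have ae: "AE t in lborel. (LINT x|lborel. g (x, t)) = (LINT x|lebesgue. f (x, t))"
    by (auto elim: eventually_mono)
  have gt: "integrable lborel (\<lambda>t. LINT x|lborel. g (x, t))"
    using lborel_pair.integrable_snd[OF gi2] .
  have gtl: "integrable lebesgue (\<lambda>t. LINT x|lborel. g (x, t))"
    using gt by (subst integrable_completion) auto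
  show fi: "integrable lebesgue (\<lambda>t. LINT x|lebesgue. f (x, t))"
    by (rule integrable_cong_AE_imp[OF gtl borel_measurable_AE[OF borel_measurable_integrable[OF gtl]
          AE_completion[OF ae]] AE_completion[OF ae]])
  have "(LINT p|lebesgue. f p) = (LINT p|lborel. g p)"
    using fg' gl borel_measurable_integrable[OF assms]
    by (subst integral_completion[OF g, symmetric], intro integral_cong_AE) auto
  also have "\<dots> = (LINT t|lborel. LINT x|lborel. g (x, t))"
    using lborel_pair.integral_snd[OF gi2] by (simp add: lborel_prod)
  also have "\<dots> = (LINT t|lebesgue. LINT x|lborel. g (x, t))"
    by (subst integral_completion) (use gt in auto)
  also have "\<dots> = (LINT t|lebesgue. LINT x|lebesgue. f (x, t))"
    using AE_completion[OF ae] gtl fi by (intro integral_cong_AE) auto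
  finally show "(LINT p|lebesgue. f p) = (LINT t|lebesgue. LINT x|lebesgue. f (x, t))" .
qed

lemma interval_integral_FTC_lebesgue:
  fixes F f :: "real \<Rightarrow> real"
  assumes "a \<le> b" "\<And>t. (F has_real_derivative f t) (at t)" "continuous_on UNIV f"
  shows "(LINT t:{a<..<b}|lebesgue. f t) = F b - F a"
proof -
  have int: "integrable lborel (\<lambda>x. indicator {a..b} x *\<^sub>R f x)"
    by (intro borel_integrable_compact compact_Icc continuous_on_subset[OF assms(3)]) auto
  have "(LINT t:{a<..<b}|lebesgue. f t) = (LINT t:{a..b}|lebesgue. f t)"
  proof (rule set_integral_cong_set)
    show "set_borel_measurable lebesgue {a..b} f"
      using int unfolding set_borel_measurable_def
      by (auto intro: measurable_completion dest: borel_measurable_integrable)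
    show "set_borel_measurable lebesgue {a<..<b} f"
      using set_integrable_continuous[OF assms(3), of "{a<..<b}"]
      by (auto simp: set_integrable_def set_borel_measurable_def dest: borel_measurable_integrable)
    have "AE t in lebesgue. t \<notin> {a, b}"
      by (intro AE_not_in) (simp flip: negligible_iff_null_sets)
    then show "AE t in lebesgue. (t \<in> {a..b}) = (t \<in> {a<..<b})"
      by (rule eventually_mono) auto
  qed
  also have "\<dots> = (LINT t|lborel. indicator {a..b} t *\<^sub>R f t)"
    unfolding set_lebesgue_integral_def using int by (simp add: integral_completion)
  also have "\<dots> = F b - F a"
    using assms
    by (intro integral_FTC_atLeastAtMost)
      (auto intro: continuous_on_subset has_field_derivative_at_within simp flip: has_real_derivative_iff_has_vector_derivative)
  finally show ?thesis .
qed

section \<open>Exponential moments of the control\<close>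

text \<open>The function on the left is a finite Blaschke product, with zeros in \<open>S\<close>, times \<open>1 / (s + b)\<close>. It is
  the Laplace transform of \<open>\<lambda>u. \<Sum>i\<in>insert b S. c i * exp (- (i * u))\<close>.\<close>

lemma partial_fractions_blaschke:
  fixes b :: real
  assumes "finite S" "\<And>a. a \<in> S \<Longrightarrow> a > 0" "b > 0" "b \<notin> S"
  shows "\<exists>c. c b = (\<Prod>a\<in>S. (b + a) / (b - a)) \<and>
     (\<forall>s>0. (\<Prod>a\<in>S. (s - a) / (s + a)) / (s + b) = (\<Sum>i\<in>insert b S. c i / (s + i)))"
  using assms
proof (induction S rule: finite_induct)
  case empty
  show ?case by (rule exI[of _ "\<lambda>_. 1"]) simp
next
  case (insert a S)
  then obtain c where c: "c b = (\<Prod>a\<in>S. (b + a) / (b - a))"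
    "\<And>s. s > 0 \<Longrightarrow> (\<Prod>a\<in>S. (s - a) / (s + a)) / (s + b) = (\<Sum>i\<in>insert b S. c i / (s + i))"
    by auto
  have a: "a > 0" "a \<noteq> b" "a \<notin> insert b S" using insert by auto
  define c' where "c' i = (if i = a then - (\<Sum>i\<in>insert b S. 2 * a * c i / (i - a))
     else c i * ((i + a) / (i - a)))" for i
  have "(\<Prod>a\<in>insert a S. (s - a) / (s + a)) / (s + b) = (\<Sum>i\<in>insert b (insert a S). c' i / (s + i))"
    if s: "s > 0" for s
  proof -
    have frac: "(s - a) / (s + a) * (c i / (s + i)) =
        c i * ((i + a) / (i - a)) / (s + i) - (2 * a * c i / (i - a)) / (s + a)"
      if i: "i \<in> insert b S" for i
    proof -
      have "i > 0" "i \<noteq> a" using i insert a by auto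
      then have "s + i \<noteq> 0" "s + a \<noteq> 0" "i - a \<noteq> 0" using s a by auto
      then show ?thesis by (simp add: divide_simps) algebra
    qed
    have "(\<Prod>a\<in>insert a S. (s - a) / (s + a)) / (s + b) =
        (s - a) / (s + a) * (\<Sum>i\<in>insert b S. c i / (s + i))"
      unfolding c(2)[OF s, symmetric] using insert.hyps by simp
    also have "\<dots> = (\<Sum>i\<in>insert b S. c i * ((i + a) / (i - a)) / (s + i) - (2 * a * c i / (i - a)) / (s + a))"
      unfolding sum_distrib_left by (intro sum.cong refl frac)
    also have "\<dots> = (\<Sum>i\<in>insert b S. c i * ((i + a) / (i - a)) / (s + i)) + c' a / (s + a)"
      by (simp only: sum_subtractf c'_def if_True refl sum_divide_distrib minus_divide_left[symmetric] add_uminus_conv_diff)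
    also have "(\<Sum>i\<in>insert b S. c i * ((i + a) / (i - a)) / (s + i)) = (\<Sum>i\<in>insert b S. c' i / (s + i))"
      using a by (intro sum.cong) (auto simp: c'_def)
    also have "\<dots> + c' a / (s + a) = (\<Sum>i\<in>insert a (insert b S). c' i / (s + i))"
      using insert.hyps a by (subst (2) sum.insert) auto
    finally show ?thesis by (simp add: insert_commute)
  qed
  moreover have "c' b = (\<Prod>a\<in>insert a S. (b + a) / (b - a))"
    using insert.hyps a c(1) by (simp add: c'_def mult.commute)
  ultimately show ?case by blast
qed

text \<open>The right-hand side is the squared norm of the exponential sum in \<open>L\<^sup>2(0,\<infinity>)\<close>.\<close>

lemma exponential_sum_norm_le:
  fixes c :: "real \<Rightarrow> real"
  assumes "finite I" "\<And>i. i \<in> I \<Longrightarrow> i > 0" "T \<ge> 0"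
  shows "(LINT t:{0<..<T}|lebesgue. (\<Sum>i\<in>I. c i * exp (- (i * (T - t))))\<^sup>2)
     \<le> (\<Sum>i\<in>I. \<Sum>j\<in>I. c i * c j / (i + j))"
proof -
  define q where "q u = (\<Sum>i\<in>I. c i * exp (- (i * u)))" for u
  \<comment> \<open>the integral of the square over \<open>(u, \<infinity>)\<close>, hence decreasing to 0 and nonnegative\<close>
  define G where "G u = (\<Sum>i\<in>I. \<Sum>j\<in>I. c i * c j / (i + j) * exp (- ((i + j) * u)))" for u
  have G: "(G has_real_derivative - (q u)\<^sup>2) (at u)" for u
  proof -
    have "(G has_real_derivative (\<Sum>i\<in>I. \<Sum>j\<in>I. - (c i * exp (- (i * u)) * (c j * exp (- (j * u)))))) (at u)"
      unfolding G_def
    proof (intro DERIV_sum)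
      fix i j assume "i \<in> I" "j \<in> I"
      then have "i + j > 0" using assms(2) by (simp add: add_pos_pos)
      moreover have "exp (- ((i + j) * u)) = exp (- (i * u)) * exp (- (j * u))"
        by (simp add: algebra_simps flip: exp_add)
      moreover have gen: "k \<noteq> 0 \<Longrightarrow> x / k * (e * - k) = - (x * e)" for x k e :: real by simp
      moreover have "((\<lambda>u. c i * c j / (i + j) * exp (- ((i + j) * u))) has_real_derivative
          c i * c j / (i + j) * (exp (- ((i + j) * u)) * - (i + j))) (at u)"
        using \<open>i + j > 0\<close> by (auto intro!: derivative_eq_intros)
      moreover have "c i * c j / (i + j) * (exp (- (i * u)) * exp (- (j * u)) * - (i + j)) =
          - (c i * exp (- (i * u)) * (c j * exp (- (j * u))))"
        using gen[of "i + j" "c i * c j" "exp (- (i * u)) * exp (- (j * u))"] \<open>i + j > 0\<close> by (simp only: mult_ac)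
      ultimately show "((\<lambda>u. c i * c j / (i + j) * exp (- ((i + j) * u))) has_real_derivative
          - (c i * exp (- (i * u)) * (c j * exp (- (j * u))))) (at u)"
        by simp
    qed
    also have "(\<Sum>i\<in>I. \<Sum>j\<in>I. - (c i * exp (- (i * u)) * (c j * exp (- (j * u))))) = - (q u)\<^sup>2"
      by (simp add: q_def power2_eq_square sum_product sum_negf)
    finally show ?thesis .
  qed
  have "(G \<longlongrightarrow> 0) at_top"
  proof -
    have "((\<lambda>u. \<Sum>i\<in>I. \<Sum>j\<in>I. c i * c j / (i + j) * exp (- ((i + j) * u))) \<longlongrightarrow> (\<Sum>i\<in>I. \<Sum>j\<in>I. c i * c j / (i + j) * 0)) at_top"
    proof (intro tendsto_intros)
      fix i j assume "i \<in> I" "j \<in> I"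
      then have "i + j > 0" using assms(2) by (simp add: add_pos_pos)
      then have "filterlim (\<lambda>u. (i + j) * u) at_top at_top"
        by (intro filterlim_tendsto_pos_mult_at_top[OF tendsto_const] filterlim_ident)
      then show "((\<lambda>u. exp (- ((i + j) * u))) \<longlongrightarrow> 0) at_top"
        by (intro filterlim_compose[OF exp_at_bot]) (simp add: filterlim_uminus_at_bot)
    qed
    then show ?thesis unfolding G_def by simp
  qed
  moreover have "G u \<ge> G u'" if "u \<le> u'" for u u'
    by (rule DERIV_nonpos_imp_nonincreasing[OF that]) (use G in \<open>force\<close>)
  ultimately have "G T \<ge> 0"
    by (intro tendsto_upperbound[of G 0 at_top "G T"] eventually_mono[OF eventually_ge_at_top[of T]]) auto
  moreover have "(LINT t:{0<..<T}|lebesgue. (q (T - t))\<^sup>2) = - G (T - T) * (-1) - - G (T - 0) * (-1)"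
  proof (subst interval_integral_FTC_lebesgue[OF assms(3)])
    show "((\<lambda>t. G (T - t)) has_real_derivative (q (T - t))\<^sup>2) (at t)" for t
      by (rule DERIV_cong[OF DERIV_chain'[OF _ G]]) (auto intro!: derivative_eq_intros)
    show "continuous_on UNIV (\<lambda>t. (q (T - t))\<^sup>2)"
      unfolding q_def by (intro continuous_intros)
  qed simp
  ultimately show ?thesis
    by (simp add: q_def G_def)
qed

text \<open>A control that is orthogonal to the exponentials with exponents in \<open>S\<close> cannot have a large moment
  at \<open>b\<close>, because the distance of \<open>exp (- b u)\<close> to their span is small. For the Blaschke coefficients \<open>c\<close>
  the Gram form \<open>\<Sum>i. \<Sum>j. c i * c j / (i + j)\<close> is the sum of \<open>c i\<close> times the rational function of
  \<open>partial_fractions_blaschke\<close> at \<open>i\<close>; it vanishes on \<open>S\<close>, so only \<open>i = b\<close> survives, which gives \<open>1 / (2 b)\<close>. Testing with this combination, in which \<open>exp (- b u)\<close>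
  has the large coefficient \<open>c b\<close>, gives the bound.\<close>

lemma moment_bound_by_vanishing_moments:
  fixes b :: real and v :: "real \<Rightarrow> real"
  assumes S: "finite S" "\<And>a. a \<in> S \<Longrightarrow> a > 0" and b: "b > 0" "b \<notin> S" and T: "T \<ge> 0"
    and v: "v \<in> L2 {0<..<T}"
    and vanish: "\<And>a. a \<in> S \<Longrightarrow> (LINT t:{0<..<T}|lebesgue. v t * exp (- (a * (T - t)))) = 0"
  shows "\<bar>LINT t:{0<..<T}|lebesgue. v t * exp (- (b * (T - t)))\<bar>
     \<le> (\<Prod>a\<in>S. \<bar>b - a\<bar> / (b + a)) * ((LINT t:{0<..<T}|lebesgue. (v t)\<^sup>2) + 1 / (2 * b)) / 2"
proof -
  obtain c where cb: "c b = (\<Prod>a\<in>S. (b + a) / (b - a))"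
    and c: "\<And>s. s > 0 \<Longrightarrow> (\<Prod>a\<in>S. (s - a) / (s + a)) / (s + b) = (\<Sum>i\<in>insert b S. c i / (s + i))"
    using partial_fractions_blaschke[OF S b] by blast
  define q where "q t = (\<Sum>i\<in>insert b S. c i * exp (- (i * (T - t))))" for t
  define P where "P = (\<Prod>a\<in>S. \<bar>b - a\<bar> / (b + a))"
  have "P > 0" unfolding P_def using S(2) b by (intro prod_pos) (auto intro!: divide_pos_pos add_pos_pos)
  have inv: "\<bar>c b\<bar> * P = 1"
    unfolding cb P_def abs_prod prod.distrib[symmetric]
  proof (intro prod.neutral ballI)
    fix a assume "a \<in> S"
    then have "b + a > 0" "b - a \<noteq> 0" using S(2) b by (auto simp: add_pos_pos)
    then show "\<bar>(b + a) / (b - a)\<bar> * (\<bar>b - a\<bar> / (b + a)) = 1" by (simp add: abs_divide)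
  qed
  have "(\<Sum>i\<in>insert b S. \<Sum>j\<in>insert b S. c i * c j / (i + j)) =
     (\<Sum>i\<in>insert b S. c i * ((\<Prod>a\<in>S. (i - a) / (i + a)) / (i + b)))"
  proof (intro sum.cong refl)
    fix i assume "i \<in> insert b S"
    then have "i > 0" using S(2) b by auto
    have "(\<Sum>j\<in>insert b S. c i * c j / (i + j)) = c i * (\<Sum>j\<in>insert b S. c j / (i + j))"
      by (simp only: sum_distrib_left times_divide_eq_right)
    then show "(\<Sum>j\<in>insert b S. c i * c j / (i + j)) = c i * ((\<Prod>a\<in>S. (i - a) / (i + a)) / (i + b))"
      using c[OF \<open>i > 0\<close>] by simp
  qed
  also have "\<dots> = (\<Sum>i\<in>{b}. c i * ((\<Prod>a\<in>S. (i - a) / (i + a)) / (i + b)))"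
    using S(1) by (intro sum.mono_neutral_right) auto
  also have "\<dots> = 1 / (2 * b)"
  proof -
    have "c b * (\<Prod>a\<in>S. (b - a) / (b + a)) = 1"
      unfolding cb prod.distrib[symmetric]
    proof (intro prod.neutral ballI)
      fix a assume "a \<in> S"
      then have "b + a > 0" "b - a \<noteq> 0" using S(2) b by (auto simp: add_pos_pos)
      then show "(b + a) / (b - a) * ((b - a) / (b + a)) = 1" by simp
    qed
    then show ?thesis by simp
  qed
  finally have q2: "(LINT t:{0<..<T}|lebesgue. (q t)\<^sup>2) \<le> 1 / (2 * b)"
    using exponential_sum_norm_le[of "insert b S" T c] S b T by (auto simp: q_def)
  have qc: "continuous_on UNIV q" unfolding q_def by (intro continuous_intros)
  have vq: "set_integrable lebesgue {0<..<T} (\<lambda>t. v t * q t)"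
    by (intro L2_times_continuous_integrable v qc) auto
  have ve: "set_integrable lebesgue {0<..<T} (\<lambda>t. v t * exp (- (i * (T - t))))" for i
    by (intro L2_times_continuous_integrable v continuous_intros) auto
  have v2: "set_integrable lebesgue {0<..<T} (\<lambda>t. (v t)\<^sup>2)" using v by (simp add: L2_def)
  have qq: "set_integrable lebesgue {0<..<T} (\<lambda>t. (q t)\<^sup>2)"
    by (intro set_integrable_continuous continuous_intros qc) auto
  have "(LINT t:{0<..<T}|lebesgue. v t * q t) =
      (\<Sum>i\<in>insert b S. c i * (LINT t:{0<..<T}|lebesgue. v t * exp (- (i * (T - t)))))"
  proof -
    have "(LINT t:{0<..<T}|lebesgue. v t * q t) = (LINT t|lebesgue. (\<Sum>i\<in>insert b S.
        c i * (indicator {0<..<T} t *\<^sub>R (v t * exp (- (i * (T - t)))))))"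
      unfolding set_lebesgue_integral_def q_def
      by (intro Bochner_Integration.integral_cong) (simp_all add: sum_distrib_left mult_ac)
    also have "\<dots> = (\<Sum>i\<in>insert b S. c i * (LINT t:{0<..<T}|lebesgue. v t * exp (- (i * (T - t)))))"
      unfolding set_lebesgue_integral_def using ve unfolding set_integrable_def
      by (subst Bochner_Integration.integral_sum) auto
    finally show ?thesis .
  qed
  also have "\<dots> = c b * (LINT t:{0<..<T}|lebesgue. v t * exp (- (b * (T - t))))"
    using S(1) b(2) vanish by simp
  finally have "\<bar>c b\<bar> * \<bar>LINT t:{0<..<T}|lebesgue. v t * exp (- (b * (T - t)))\<bar> = \<bar>LINT t:{0<..<T}|lebesgue. v t * q t\<bar>"
    by (simp add: abs_mult)
  also have "\<dots> \<le> (LINT t:{0<..<T}|lebesgue. \<bar>v t * q t\<bar>)"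
    using integral_abs_bound[of lebesgue "\<lambda>t. indicator {0<..<T} t *\<^sub>R (v t * q t)"]
    by (simp add: set_lebesgue_integral_def abs_mult)
  also have "\<dots> \<le> (LINT t:{0<..<T}|lebesgue. ((v t)\<^sup>2 + (q t)\<^sup>2) / 2)"
  proof (rule set_integral_mono)
    show "\<bar>v t * q t\<bar> \<le> ((v t)\<^sup>2 + (q t)\<^sup>2) / 2" for t
      using sum_squares_bound[of "\<bar>v t\<bar>" "\<bar>q t\<bar>"] by (simp add: abs_mult)
  qed (use vq v2 qq in \<open>auto intro: set_integrable_abs\<close>)
  also have "\<dots> = ((LINT t:{0<..<T}|lebesgue. (v t)\<^sup>2) + (LINT t:{0<..<T}|lebesgue. (q t)\<^sup>2)) / 2"
    using v2 qq by simp
  also have "\<dots> \<le> ((LINT t:{0<..<T}|lebesgue. (v t)\<^sup>2) + 1 / (2 * b)) / 2"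
    using q2 by simp
  finally have "P * (\<bar>c b\<bar> * \<bar>LINT t:{0<..<T}|lebesgue. v t * exp (- (b * (T - t)))\<bar>)
    \<le> P * (((LINT t:{0<..<T}|lebesgue. (v t)\<^sup>2) + 1 / (2 * b)) / 2)"
    using \<open>P > 0\<close> by (intro mult_left_mono) auto
  moreover have "P * (\<bar>c b\<bar> * M) = M" for M
    using inv by (metis mult.assoc mult.commute mult_1)
  ultimately show ?thesis unfolding P_def[symmetric] by (simp only: times_divide_eq_right)
qed

text \<open>Of the exponents \<open>(15 i)\<^sup>2\<close> below \<open>b = (30 n + 1)\<^sup>2\<close>, the \<open>n\<close> largest are at least \<open>b / 4\<close>. Each of
  them contributes a factor \<open>(b - a) / (b + a) \<le> 3 / 5\<close>.\<close>

lemma moments_decay_geometrically: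
  fixes v :: "real \<Rightarrow> real"
  assumes T: "T \<ge> 0" and v: "v \<in> L2 {0<..<T}"
    and vanish: "\<And>i::nat. i \<ge> 1 \<Longrightarrow> (LINT t:{0<..<T}|lebesgue. v t * exp (- ((15 * real i)\<^sup>2 * (T - t)))) = 0"
  shows "\<bar>LINT t:{0<..<T}|lebesgue. v t * exp (- ((30 * real n + 1)\<^sup>2 * (T - t)))\<bar>
     \<le> (3 / 5) ^ n * ((LINT t:{0<..<T}|lebesgue. (v t)\<^sup>2) + 1)"
proof -
  define b where "b = (30 * real n + 1)\<^sup>2"
  define S where "S = (\<lambda>i. (15 * real i)\<^sup>2) ` {n+1..2*n}"
  have "b \<ge> 1" unfolding b_def by (auto intro!: one_le_power)
  have bounds: "0 < a \<and> b / 4 \<le> a \<and> a < b" if a: "a \<in> S" for a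
  proof -
    obtain i where i: "a = (15 * real i)\<^sup>2" "n + 1 \<le> i" "i \<le> 2 * n"
      using a[unfolded S_def] by (elim imageE) (simp only: atLeastAtMost_iff)
    have "b / 4 = ((30 * real n + 1) / 2)\<^sup>2" by (simp add: b_def power_divide)
    also have "\<dots> \<le> a" unfolding i(1) using i(2) by (intro power_mono) auto
    finally have "b / 4 \<le> a" .
    moreover have "a < b" unfolding i(1) b_def using i(3) by (intro power_strict_mono) auto
    ultimately show ?thesis using \<open>b \<ge> 1\<close> by auto
  qed
  have "inj_on (\<lambda>i. (15 * real i)\<^sup>2) {n+1..2*n}"
    by (auto simp: inj_on_def power2_eq_iff_nonneg)
  then have "card S = n" unfolding S_def by (simp add: card_image)
  have "(\<Prod>a\<in>S. \<bar>b - a\<bar> / (b + a)) \<le> (\<Prod>a\<in>S. 3 / 5)"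
  proof (intro prod_mono conjI)
    fix a assume "a \<in> S"
    from bounds[OF this] show "0 \<le> \<bar>b - a\<bar> / (b + a)" "\<bar>b - a\<bar> / (b + a) \<le> 3 / 5"
      by (auto simp: divide_simps)
  qed
  then have P: "(\<Prod>a\<in>S. \<bar>b - a\<bar> / (b + a)) \<le> (3 / 5) ^ n"
    using \<open>card S = n\<close> by simp
  define V where "V = (LINT t:{0<..<T}|lebesgue. (v t)\<^sup>2)"
  have V: "V \<ge> 0"
    unfolding V_def set_lebesgue_integral_def
    by (intro Bochner_Integration.integral_nonneg) (auto simp: indicator_def)
  have "\<bar>LINT t:{0<..<T}|lebesgue. v t * exp (- (b * (T - t)))\<bar>
     \<le> (\<Prod>a\<in>S. \<bar>b - a\<bar> / (b + a)) * (V + 1 / (2 * b)) / 2"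
    unfolding V_def
  proof (rule moment_bound_by_vanishing_moments[OF _ _ _ _ T v])
    show "finite S" by (simp add: S_def)
    show "(LINT t:{0<..<T}|lebesgue. v t * exp (- (a * (T - t)))) = 0" if "a \<in> S" for a
      using that unfolding S_def
    proof (elim imageE)
      fix i assume "a = (15 * real i)\<^sup>2" "i \<in> {n+1..2*n}"
      then show ?thesis using vanish[of i] by simp
    qed
  qed (use bounds \<open>b \<ge> 1\<close> in force)+
  also have "\<dots> \<le> (3 / 5) ^ n * (V + 1) / 2"
  proof (intro divide_right_mono mult_mono P)
    show "V + 1 / (2 * b) \<le> V + 1" using \<open>b \<ge> 1\<close> by simp
    show "0 \<le> V + 1 / (2 * b)" using V \<open>b \<ge> 1\<close> by simp
  qed auto
  also have "\<dots> \<le> (3 / 5) ^ n * (V + 1)" using V by simp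
  finally show ?thesis by (simp add: b_def V_def)
qed

lemma weighted_exponential_integral_ge:
  fixes T b :: real
  assumes "T > 0" "b \<ge> 1"
  shows "exp (- T) * (1 - exp (- T)) / b \<le> (LINT t:{0<..<T}|lebesgue. exp (- t) * exp (- (b * (T - t))))"
proof -
  have "exp (- T) * (1 - exp (- T)) / b \<le> exp (- T) * (1 - exp (- (b * T))) / b"
    by (intro divide_right_mono mult_left_mono) (use assms in \<open>auto simp: mult_le_cancel_right1\<close>)
  also have "\<dots> = (LINT t:{0<..<T}|lebesgue. exp (- T) * exp (- (b * (T - t))))"
  proof -
    have "(LINT t:{0<..<T}|lebesgue. exp (- (b * (T - t)))) = exp (- (b * (T - T))) / b - exp (- (b * (T - 0))) / b"
      by (rule interval_integral_FTC_lebesgue) (use assms in \<open>auto intro!: derivative_eq_intros continuous_intros\<close>)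
    then show ?thesis by (simp flip: diff_divide_distrib)
  qed
  also have "\<dots> \<le> (LINT t:{0<..<T}|lebesgue. exp (- t) * exp (- (b * (T - t))))"
    by (intro set_integral_mono set_integrable_continuous continuous_intros) auto
  finally show ?thesis .
qed

section \<open>Weak derivatives of smooth functions\<close>

lemma has_derivative_0_off_support:
  assumes "(f has_derivative f') (at x)" "closed K" "\<And>x. x \<notin> K \<Longrightarrow> f x = 0" "x \<notin> K"
  shows "f' = (\<lambda>_. 0)"
proof -
  have "((\<lambda>_. 0) has_derivative f') (at x)"
    by (rule has_derivative_transform_within_open[OF assms(1), of "- K"])
      (use assms in \<open>auto simp: open_Compl\<close>)
  then show ?thesis
    using has_derivative_unique has_derivative_const by blast
qed

text \<open>Translation invariance makes the integral of every difference quotient of \<open>F\<close> in direction \<open>b\<close>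
  vanish. By the mean value theorem the quotients are bounded by a constant multiple of the indicator of a
  compact set, so dominated convergence carries this over to the derivative. Only Lebesgue measure is
  used, hence the same argument serves the interval and the space-time rectangle.\<close>

lemma integral_directional_derivative_eq_0:
  fixes F :: "'a::euclidean_space \<Rightarrow> real"
  assumes D: "\<And>x. (F has_derivative DF x) (at x)"
    and cont: "continuous_on UNIV (\<lambda>x. DF x b)"
    and K: "compact K" "\<And>x. x \<notin> K \<Longrightarrow> F x = 0"
  shows "(LINT x|lborel. DF x b) = 0"
proof -
  \<comment> \<open>every point from which the segment to its translate by \<open>b\<close> meets \<open>K\<close>\<close>
  define L where "L = (\<lambda>(x, s). x - s *\<^sub>R b) ` (K \<times> {0..1::real})"
  have "compact L"
    unfolding L_def split_def
    by (intro compact_continuous_image continuous_intros compact_Times K compact_Icc)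
  have inL: "x \<in> L" if "x + s *\<^sub>R b \<in> K" "0 \<le> s" "s \<le> 1" for x s
    unfolding L_def by (rule image_eqI[of _ _ "(x + s *\<^sub>R b, s)"]) (use that in auto)
  have contF: "continuous_on UNIV F"
    using D by (intro continuous_at_imp_continuous_on ballI has_derivative_continuous) 
  have DF0: "DF x b = 0" if "x \<notin> K" for x
    using has_derivative_0_off_support[OF D compact_imp_closed[OF K(1)] K(2) that] by simp
  have "compact ((\<lambda>x. DF x b) ` K)"
    by (intro compact_continuous_image continuous_on_subset[OF cont] K) auto
  then obtain M where M: "\<And>x. x \<in> K \<Longrightarrow> \<bar>DF x b\<bar> \<le> M"
    unfolding bounded_iff compact_eq_bounded_closed by auto
  define M' where "M' = max M 0"
  have M': "\<bar>DF x b\<bar> \<le> M'" for x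
    using M[of x] DF0[of x] by (cases "x \<in> K") (auto simp: M'_def)
  define h :: "nat \<Rightarrow> real" where "h n = inverse (real (Suc n))" for n
  have h: "0 < h n" "h n \<le> 1" for n
    by (auto simp: h_def field_simps)
  have h0: "h \<longlonglongrightarrow> 0" unfolding h_def by (rule LIMSEQ_inverse_real_of_nat)
  define q where "q n x = (F (x + h n *\<^sub>R b) - F x) / h n" for n x
  have line: "((\<lambda>s. F (x + s *\<^sub>R b)) has_real_derivative DF (x + s *\<^sub>R b) b) (at s)" for x s
  proof -
    have "((\<lambda>s. F (x + s *\<^sub>R b)) has_derivative (\<lambda>s'. DF (x + s *\<^sub>R b) (s' *\<^sub>R b))) (at s)"
      by (rule has_derivative_compose[of "\<lambda>s. x + s *\<^sub>R b" "\<lambda>s'. s' *\<^sub>R b" _ _ F])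
        (auto intro!: derivative_eq_intros D)
    moreover have "DF (x + s *\<^sub>R b) (s' *\<^sub>R b) = DF (x + s *\<^sub>R b) b * s'" for s'
      using linear_simps(5)[OF has_derivative_bounded_linear[OF D[of "x + s *\<^sub>R b"]], of s' b]
      by (simp add: mult.commute)
    ultimately show ?thesis by (simp add: has_field_derivative_def)
  qed
  have qbound: "norm (q n x) \<le> M' * indicator L x" for n x
  proof (cases "x \<in> L")
    case True
    obtain s where "0 < s" "s < h n" "F (x + h n *\<^sub>R b) - F (x + 0 *\<^sub>R b) = (h n - 0) * DF (x + s *\<^sub>R b) b"
      using MVT2[of 0 "h n" "\<lambda>s. F (x + s *\<^sub>R b)" "\<lambda>s. DF (x + s *\<^sub>R b) b"] line h by blast
    then have "q n x = DF (x + s *\<^sub>R b) b" using h[of n] by (simp add: q_def)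
    with M' True show ?thesis by simp
  next
    case False
    then have "F (x + h n *\<^sub>R b) = 0" "F x = 0"
      using inL[of x "h n"] inL[of x 0] h[of n] K(2) by force+
    then show ?thesis by (simp add: q_def False)
  qed
  have "(\<lambda>n. q n x) \<longlonglongrightarrow> DF x b" for x
  proof -
    have "((\<lambda>s. (F (x + s *\<^sub>R b) - F (x + 0 *\<^sub>R b)) / (s - 0)) \<longlongrightarrow> DF x b) (at 0)"
      using line[of x 0] unfolding has_field_derivative_iff by simp
    moreover have "filterlim h (at 0) sequentially"
      unfolding filterlim_at using h0 h by (auto simp: less_le)
    ultimately show ?thesis unfolding q_def by (auto dest: filterlim_compose)
  qed
  moreover have qm: "q n \<in> borel_measurable lborel" for n
  proof -
    have "continuous_on UNIV (q n)"
      unfolding q_def using h[of n] by (intro continuous_intros continuous_on_compose2[OF contF]) auto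
    then show ?thesis by (simp add: borel_measurable_continuous_onI)
  qed
  moreover have "integrable lborel (\<lambda>x. M' * indicator L x)"
    using \<open>compact L\<close> emeasure_bounded_finite[of L]
    by (intro integrable_mult_right integrable_real_indicator) (auto simp: borel_compact compact_imp_bounded)
  ultimately have "(\<lambda>n. LINT x|lborel. q n x) \<longlonglongrightarrow> (LINT x|lborel. DF x b)"
    using qbound
    by (intro integral_dominated_convergence[where w="\<lambda>x. M' * indicator L x"])
       (auto intro!: borel_measurable_continuous_onI cont)
  moreover have "(LINT x|lborel. q n x) = 0" for n
  proof -
    have "integrable lborel (\<lambda>x. indicator K x *\<^sub>R F x)"
      by (intro borel_integrable_compact K continuous_on_subset[OF contF]) auto
    also have "(\<lambda>x. indicator K x *\<^sub>R F x) = F"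
      using K(2) by (auto simp: indicator_def fun_eq_iff)
    finally have Fi: "integrable lborel F" .
    have eq: "(LINT x|lborel. F x) = (LINT x|lborel. F (x + h n *\<^sub>R b))"
      using lborel_distr_plus[of "h n *\<^sub>R b"] borel_measurable_integrable[OF Fi]
      by (subst lborel_distr_plus[of "h n *\<^sub>R b", symmetric], subst integral_distr) (auto simp: add.commute)
    have "integrable lborel (\<lambda>x. F (h n *\<^sub>R b + x))"
      using Fi borel_measurable_integrable[OF Fi] integrable_distr_eq[of "(+) (h n *\<^sub>R b)" lborel borel F]
      unfolding lborel_distr_plus by simp
    with Fi eq show ?thesis unfolding q_def by (simp add: add.commute)
  qed
  ultimately show ?thesis
    using LIMSEQ_unique[OF _ tendsto_const] by simp
qed

text \<open>Integration by parts: \<open>f\<close> times a test function is continuously differentiable in direction \<open>b\<close>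
  with compact support, whatever \<open>f\<close> does near the boundary of \<open>\<Omega>\<close>.\<close>

lemma weak_deriv_if_classical:
  fixes f :: "'a::euclidean_space \<Rightarrow> real"
  assumes D: "\<And>x. (f has_derivative Df x) (at x)"
    and cont: "continuous_on UNIV (\<lambda>x. Df x b)"
  shows "weak_deriv \<Omega> b f (\<lambda>x. Df x b)"
  unfolding weak_deriv_def
proof (intro allI impI)
  fix \<eta> D\<eta> assume "test_function \<Omega> \<eta> D\<eta>"
  then obtain K where \<eta>: "\<And>x. (\<eta> has_derivative D\<eta> x) (at x)" "continuous_on UNIV (\<lambda>x. D\<eta> x b)"
    and K: "compact K" "K \<subseteq> \<Omega>" "\<And>x. x \<notin> K \<Longrightarrow> \<eta> x = 0"
    unfolding test_function_def by blast
  have D\<eta>0: "D\<eta> x b = 0" if "x \<notin> K" for x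
    using has_derivative_0_off_support[OF \<eta>(1) compact_imp_closed[OF K(1)] K(3) that] by simp
  have cf: "continuous_on UNIV f" and c\<eta>: "continuous_on UNIV \<eta>"
    using D \<eta>(1) by (intro continuous_at_imp_continuous_on ballI has_derivative_continuous; blast)+
  have int: "integrable lborel u" "(LINT x:\<Omega>|lebesgue. u x) = (LINT x|lborel. u x)"
    if u: "continuous_on UNIV u" "\<And>x. x \<notin> K \<Longrightarrow> u x = 0" for u :: "'a \<Rightarrow> real"
  proof -
    have "integrable lborel (\<lambda>x. indicator K x *\<^sub>R u x)"
      by (intro borel_integrable_compact K continuous_on_subset[OF u(1)]) auto
    also have "(\<lambda>x. indicator K x *\<^sub>R u x) = u"
      using u(2) by (auto simp: indicator_def fun_eq_iff)
    finally show "integrable lborel u" .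
    have "(\<lambda>x. indicator \<Omega> x *\<^sub>R u x) = u"
      using u(2) K(2) by (auto simp: indicator_def fun_eq_iff)
    then show "(LINT x:\<Omega>|lebesgue. u x) = (LINT x|lborel. u x)"
      unfolding set_lebesgue_integral_def using \<open>integrable lborel u\<close>
      by (simp add: integral_completion)
  qed
  have A: "continuous_on UNIV (\<lambda>x. f x * D\<eta> x b)" "\<And>x. x \<notin> K \<Longrightarrow> f x * D\<eta> x b = 0"
    and B: "continuous_on UNIV (\<lambda>x. Df x b * \<eta> x)" "\<And>x. x \<notin> K \<Longrightarrow> Df x b * \<eta> x = 0"
    using cf c\<eta> cont \<eta>(2) K(3) D\<eta>0 by (auto intro!: continuous_intros)
  have "(LINT x|lborel. f x * D\<eta> x b + Df x b * \<eta> x) = 0"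
    by (rule integral_directional_derivative_eq_0[of "\<lambda>x. f x * \<eta> x" "\<lambda>x h. f x * D\<eta> x h + Df x h * \<eta> x" b K])
      (use A B K in \<open>auto intro!: has_derivative_mult D \<eta> continuous_intros\<close>)
  then show "(LINT x:\<Omega>|lebesgue. f x * D\<eta> x b) = - (LINT x:\<Omega>|lebesgue. Df x b * \<eta> x)"
    using int(1)[OF A] int(1)[OF B] int(2)[OF A] int(2)[OF B] by simp
qed

section \<open>Sine coefficients of a solution by transposition\<close>

lemma open_QT: "open (QT T)" and bounded_QT: "bounded (QT T)"
  unfolding QT_def by (auto intro!: open_Times bounded_Times)

text \<open>Products of a function of \<open>t\<close> and a Dirichlet eigenfunction are the only adjoint solutions that
  the proof tests with. They are classical solutions, so the weak derivatives that strong solutions require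
  are the pointwise ones.\<close>

lemma backward_heat_solution_separated:
  fixes \<theta> \<theta>' :: "real \<Rightarrow> real" and m :: int
  assumes \<theta>: "\<And>t. (\<theta> has_real_derivative \<theta>' t) (at t)" "continuous_on UNIV \<theta>'" "\<theta> T = 0"
    and h: "\<And>x t. (x, t) \<in> QT T \<Longrightarrow> h (x, t) = ((real_of_int m)\<^sup>2 * \<theta> t - \<theta>' t) * sin (of_int m * x)"
  shows "backward_heat_solution T h (\<lambda>(x, t). \<theta> t * sin (of_int m * x))"
proof -
  define \<mu> :: real where "\<mu> = of_int m"
  have \<mu>: "sin (\<mu> * pi) = 0" unfolding \<mu>_def by (simp only: mult.commute[of _ pi] sin_npi_int)
  have c\<theta>: "continuous_on UNIV \<theta>" by (rule DERIV_continuous_on) (rule has_field_derivative_at_within[OF \<theta>(1)])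
  have \<theta>D: "(\<theta> has_derivative (\<lambda>s. \<theta>' t * s)) (at t)" for t
    using \<theta>(1)[of t] by (simp add: has_field_derivative_def)
  define \<phi> where "\<phi> = (\<lambda>p::real \<times> real. \<theta> (snd p) * sin (\<mu> * fst p))"
  define \<phi>t where "\<phi>t = (\<lambda>p::real \<times> real. \<theta>' (snd p) * sin (\<mu> * fst p))"
  define \<phi>x where "\<phi>x = (\<lambda>p::real \<times> real. \<theta> (snd p) * (\<mu> * cos (\<mu> * fst p)))"
  define \<phi>xx where "\<phi>xx = (\<lambda>p::real \<times> real. - \<mu>\<^sup>2 * \<theta> (snd p) * sin (\<mu> * fst p))"
  have cont: "continuous_on UNIV \<phi>" "continuous_on UNIV \<phi>t" "continuous_on UNIV \<phi>x" "continuous_on UNIV \<phi>xx"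
    unfolding \<phi>_def \<phi>t_def \<phi>x_def \<phi>xx_def
    by (intro continuous_intros continuous_on_compose2[OF c\<theta>] continuous_on_compose2[OF \<theta>(2)]; simp)+
  have D\<phi>: "(\<phi> has_derivative (\<lambda>q. \<phi>x p * fst q + \<phi>t p * snd q)) (at p)" for p
    unfolding \<phi>_def \<phi>x_def \<phi>t_def
    by (rule derivative_eq_intros has_derivative_compose[OF _ \<theta>D] refl | simp add: algebra_simps)+
  have D\<phi>x: "(\<phi>x has_derivative (\<lambda>q. \<phi>xx p * fst q + \<theta>' (snd p) * (\<mu> * cos (\<mu> * fst p)) * snd q)) (at p)" for p
    unfolding \<phi>x_def \<phi>xx_def
    by (rule derivative_eq_intros has_derivative_compose[OF _ \<theta>D] refl | simp add: algebra_simps power2_eq_square)+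
  have "weak_deriv (QT T) (0, 1) \<phi> \<phi>t" "weak_deriv (QT T) (1, 0) \<phi> \<phi>x" "weak_deriv (QT T) (1, 0) \<phi>x \<phi>xx"
    using weak_deriv_if_classical[OF D\<phi>, of "(0, 1)" "QT T"] weak_deriv_if_classical[OF D\<phi>, of "(1, 0)" "QT T"]
      weak_deriv_if_classical[OF D\<phi>x, of "(1, 0)" "QT T"] cont by simp_all
  moreover have "AE p in lebesgue. p \<in> QT T \<longrightarrow> - \<phi>t p = \<phi>xx p + h p"
    using h by (intro AE_I2) (auto simp: \<phi>t_def \<phi>xx_def \<mu>_def algebra_simps)
  moreover have "\<phi>t \<in> L2 (QT T)" "\<phi>x \<in> L2 (QT T)" "\<phi>xx \<in> L2 (QT T)"
    by (intro continuous_in_L2 cont open_QT bounded_QT)+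
  ultimately have "backward_heat_solution T h \<phi>"
    unfolding backward_heat_solution_def using \<theta>(3) \<mu> cont(1)
    by (auto simp: \<phi>_def intro: continuous_on_subset)
  then show ?thesis by (simp add: \<phi>_def \<mu>_def split_def)
qed

lemma backward_heat_solution_zero:
  assumes "\<And>p. p \<in> QT T \<Longrightarrow> h p = 0"
  shows "backward_heat_solution T h (\<lambda>_. 0)"
  using backward_heat_solution_separated[of "\<lambda>_. 0" "\<lambda>_. 0" T h 0] assms by (simp add: split_def)

text \<open>The component \<open>z\<close> solves an uncontrolled heat equation, so its \<open>m\<close>-th sine coefficient is
  \<open>exp (- m\<^sup>2 t)\<close> times the initial one; here this is tested against \<open>\<theta>\<close>. The test pair is \<open>\<phi> = 0\<close> and
  \<open>\<psi> = \<Theta>(t) sin (m x)\<close>, where \<open>\<Theta>\<close> solves \<open>- \<Theta>' + m\<^sup>2 \<Theta> = \<theta>\<close> backwards from \<open>\<Theta>(T) = 0\<close>.\<close>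

lemma transposition_solution_z_coefficient:
  fixes \<theta> :: "real \<Rightarrow> real" and m :: int
  assumes sol: "transposition_solution T \<alpha> (\<lambda>u. 0) (Hm1_of w) v y z Y Z" and T: "T > 0"
    and \<theta>: "continuous_on UNIV \<theta>"
  shows "(LINT p:QT T|lebesgue. z p * (\<theta> (snd p) * sin (of_int m * fst p))) =
     (LINT x:{0<..<pi}|lebesgue. w x * sin (of_int m * x)) *
     (LINT t:{0<..<T}|lebesgue. \<theta> t * exp (- ((real_of_int m)\<^sup>2 * t)))"
proof -
  define \<mu> :: real where "\<mu> = (of_int m)\<^sup>2"
  have "continuous_on UNIV (\<lambda>t. \<theta> t * exp (- (\<mu> * t)))" by (intro continuous_intros \<theta>)
  then obtain G where G: "\<And>t. (G has_real_derivative \<theta> t * exp (- (\<mu> * t))) (at t)"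
    using einterval_antiderivative[of "-\<infinity>" "\<infinity>" "\<lambda>t. \<theta> t * exp (- (\<mu> * t))"]
    by (auto simp: has_real_derivative_iff_has_vector_derivative continuous_on_eq_continuous_at)
  define \<Theta> where "\<Theta> t = exp (\<mu> * t) * (G T - G t)" for t
  have D\<Theta>: "(\<Theta> has_real_derivative \<mu> * \<Theta> t - \<theta> t) (at t)" for t
  proof -
    have "exp (\<mu> * t) * exp (- (\<mu> * t)) = 1" by (simp flip: exp_add)
    then have "exp (\<mu> * t) * (\<theta> t * exp (- (\<mu> * t))) = \<theta> t" by (metis mult.left_commute mult.right_neutral)
    then show ?thesis
      unfolding \<Theta>_def by (auto intro!: derivative_eq_intros G simp: algebra_simps)
  qed
  have c\<Theta>: "continuous_on UNIV \<Theta>" by (rule DERIV_continuous_on) (rule has_field_derivative_at_within[OF D\<Theta>])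
  have c\<Theta>': "continuous_on UNIV (\<lambda>t. \<mu> * \<Theta> t - \<theta> t)" by (intro continuous_intros c\<Theta> \<theta>)
  define g2 where "g2 = (\<lambda>p::real \<times> real. \<theta> (snd p) * sin (of_int m * fst p))"
  have "adjoint_solution T \<alpha> (\<lambda>_. 0) g2 (\<lambda>_. 0) (\<lambda>(x, t). \<Theta> t * sin (of_int m * x))"
    unfolding adjoint_solution_def
  proof
    show "backward_heat_solution T (\<lambda>_. 0) (\<lambda>_. 0)" by (rule backward_heat_solution_zero) simp
    show "backward_heat_solution T (\<lambda>(x, t). \<alpha> x * 0 + g2 (x, t)) (\<lambda>(x, t). \<Theta> t * sin (of_int m * x))"
      by (rule backward_heat_solution_separated[OF D\<Theta> c\<Theta>']) (auto simp: \<Theta>_def g2_def \<mu>_def)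
  qed
  moreover have "g2 \<in> L2 (QT T)" "(\<lambda>_. 0) \<in> L2 (QT T)"
    unfolding g2_def by (intro continuous_in_L2 open_QT bounded_QT continuous_intros continuous_on_compose2[OF \<theta>]; simp)+
  ultimately have "(LINT p:QT T|lebesgue. y p * 0 + z p * g2 p) =
      0 + Hm1_of w (\<lambda>x. (\<lambda>(x, t). \<Theta> t * sin (of_int m * x)) (x, 0)) +
      (LINT t:{0<..<T}|lebesgue. v t * dx_at_0 (\<lambda>_. 0) t)"
    using sol unfolding transposition_solution_def by blast
  moreover have "dx_at_0 (\<lambda>_. 0) t = 0" for t
    unfolding dx_at_0_def by (intro vector_derivative_within) (auto simp: trivial_limit_at_right_real)
  ultimately have "(LINT p:QT T|lebesgue. z p * g2 p) = Hm1_of w (\<lambda>x. \<Theta> 0 * sin (of_int m * x))"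
    by simp
  also have "\<dots> = \<Theta> 0 * (LINT x:{0<..<pi}|lebesgue. w x * sin (of_int m * x))"
    unfolding Hm1_of_def by (simp add: mult.left_commute)
  also have "\<Theta> 0 = (LINT t:{0<..<T}|lebesgue. \<theta> t * exp (- (\<mu> * t)))"
  proof -
    have "(LINT t:{0<..<T}|lebesgue. \<theta> t * exp (- (\<mu> * t))) = G T - G 0"
      using T by (intro interval_integral_FTC_lebesgue G continuous_intros \<theta>) simp
    then show ?thesis by (simp add: \<Theta>_def)
  qed
  finally show ?thesis by (simp add: g2_def \<mu>_def mult.commute)
qed

text \<open>The weak form of the equation for the \<open>l\<close>-th sine coefficient of \<open>y\<close>. The source \<open>g2\<close> is free, and
  \<open>g2 = - \<alpha> \<phi>\<close> allows \<open>\<psi> = 0\<close>, which decouples the adjoint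
  system.\<close>

lemma transposition_solution_y_coefficient:
  fixes \<theta> \<theta>' :: "real \<Rightarrow> real" and l :: int
  assumes sol: "transposition_solution T \<alpha> (\<lambda>u. 0) (Hm1_of w) v y z Y Z" and T: "T > 0"
    and \<alpha>: "\<And>x. x \<in> {0<..<pi} \<Longrightarrow> \<alpha> x = a x" "continuous_on UNIV a"
    and \<theta>: "\<And>t. (\<theta> has_real_derivative \<theta>' t) (at t)" "continuous_on UNIV \<theta>'" "\<theta> T = 0"
  shows "(LINT p:QT T|lebesgue. y p * (((of_int l)\<^sup>2 * \<theta> (snd p) - \<theta>' (snd p)) * sin (of_int l * fst p))) =
     (LINT p:QT T|lebesgue. z p * (a (fst p) * (\<theta> (snd p) * sin (of_int l * fst p)))) +
     of_int l * (LINT t:{0<..<T}|lebesgue. v t * \<theta> t)"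
proof -
  have c\<theta>: "continuous_on UNIV \<theta>" by (rule DERIV_continuous_on) (rule has_field_derivative_at_within[OF \<theta>(1)])
  define g1 where "g1 = (\<lambda>p::real \<times> real. ((real_of_int l)\<^sup>2 * \<theta> (snd p) - \<theta>' (snd p)) * sin (of_int l * fst p))"
  define g2 where "g2 = (\<lambda>p::real \<times> real. - (a (fst p) * (\<theta> (snd p) * sin (of_int l * fst p))))"
  define \<phi> where "\<phi> = (\<lambda>(x, t). \<theta> t * sin (real_of_int l * x))"
  have cg: "continuous_on UNIV g1" "continuous_on UNIV g2"
    unfolding g1_def g2_def
    by (intro continuous_intros continuous_on_compose2[OF c\<theta>] continuous_on_compose2[OF \<theta>(2)] continuous_on_compose2[OF \<alpha>(2)]; simp)+
  have "adjoint_solution T \<alpha> g1 g2 \<phi> (\<lambda>_. 0)"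
    unfolding adjoint_solution_def
  proof
    show "backward_heat_solution T g1 \<phi>"
      unfolding \<phi>_def by (rule backward_heat_solution_separated[OF \<theta>]) (auto simp: g1_def)
    show "backward_heat_solution T (\<lambda>(x, t). \<alpha> x * \<phi> (x, t) + g2 (x, t)) (\<lambda>_. 0)"
      by (rule backward_heat_solution_zero) (use \<alpha>(1) in \<open>auto simp: QT_def \<phi>_def g2_def\<close>)
  qed
  moreover have "g1 \<in> L2 (QT T)" "g2 \<in> L2 (QT T)"
    by (intro continuous_in_L2 open_QT bounded_QT cg)+
  ultimately have eq: "(LINT p:QT T|lebesgue. y p * g1 p + z p * g2 p) =
      0 + Hm1_of w (\<lambda>x. 0) + (LINT t:{0<..<T}|lebesgue. v t * dx_at_0 \<phi> t)"
    using sol unfolding transposition_solution_def by blast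
  have dx: "dx_at_0 \<phi> t = \<theta> t * of_int l" for t
    unfolding dx_at_0_def
  proof (rule vector_derivative_within)
    show "((\<lambda>x. \<phi> (x, t)) has_vector_derivative \<theta> t * of_int l) (at_right 0)"
      unfolding \<phi>_def has_real_derivative_iff_has_vector_derivative[symmetric]
      by (auto intro!: derivative_eq_intros)
  qed (auto simp: trivial_limit_at_right_real)
  have "y \<in> L2 (QT T)" "z \<in> L2 (QT T)"
    using sol unfolding transposition_solution_def L2_C0_Hm1_def by blast+
  note int = L2_times_continuous_integrable[OF this(1) cg(1) bounded_QT open_QT]
    L2_times_continuous_integrable[OF this(2) cg(2) bounded_QT open_QT]
  have "(LINT p:QT T|lebesgue. y p * g1 p) =
      - (LINT p:QT T|lebesgue. z p * g2 p) + of_int l * (LINT t:{0<..<T}|lebesgue. v t * \<theta> t)"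
  proof -
    have "(LINT t:{0<..<T}|lebesgue. v t * dx_at_0 \<phi> t) = of_int l * (LINT t:{0<..<T}|lebesgue. v t * \<theta> t)"
      by (simp add: dx mult.assoc[symmetric])
    then show ?thesis using eq set_integral_add(2)[OF int] by (simp add: Hm1_of_def)
  qed
  also have "- (LINT p:QT T|lebesgue. z p * g2 p) = (LINT p:QT T|lebesgue. - (z p * g2 p))"
    using set_integral_uminus[OF int(2)] by simp
  finally show ?thesis by (simp add: g1_def g2_def)
qed

lemma sine_coefficient_Fubini:
  fixes y :: "real \<times> real \<Rightarrow> real"
  assumes y: "y \<in> L2 (QT T)" and f: "continuous_on UNIV f"
  shows "set_integrable lebesgue {0<..<T} (\<lambda>t. (LINT x:{0<..<pi}|lebesgue. y (x, t) * sin (\<mu> * x)) * f t)"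
    and "(LINT p:QT T|lebesgue. y p * (f (snd p) * sin (\<mu> * fst p))) =
      (LINT t:{0<..<T}|lebesgue. (LINT x:{0<..<pi}|lebesgue. y (x, t) * sin (\<mu> * x)) * f t)"
proof -
  define F where "F p = indicator (QT T) p *\<^sub>R (y p * (f (snd p) * sin (\<mu> * fst p)))" for p
  have "continuous_on UNIV (\<lambda>p::real \<times> real. f (snd p) * sin (\<mu> * fst p))"
    by (intro continuous_intros continuous_on_compose2[OF f]) auto
  then have F: "integrable lebesgue F"
    using L2_times_continuous_integrable[OF y _ bounded_QT open_QT]
    unfolding F_def[abs_def] set_integrable_def by blast
  have inner: "(LINT x|lebesgue. F (x, t)) =
      indicator {0<..<T} t *\<^sub>R ((LINT x:{0<..<pi}|lebesgue. y (x, t) * sin (\<mu> * x)) * f t)" for t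
  proof -
    have "(LINT x|lebesgue. F (x, t)) =
      (LINT x|lebesgue. (indicator {0<..<T} t * f t) * (indicator {0<..<pi} x *\<^sub>R (y (x, t) * sin (\<mu> * x))))"
      by (intro Bochner_Integration.integral_cong) (auto simp: F_def QT_def indicator_def)
    then show ?thesis by (simp add: set_lebesgue_integral_def)
  qed
  show "set_integrable lebesgue {0<..<T} (\<lambda>t. (LINT x:{0<..<pi}|lebesgue. y (x, t) * sin (\<mu> * x)) * f t)"
    using lebesgue_Fubini_snd(1)[OF F] unfolding inner set_integrable_def .
  show "(LINT p:QT T|lebesgue. y p * (f (snd p) * sin (\<mu> * fst p))) =
      (LINT t:{0<..<T}|lebesgue. (LINT x:{0<..<pi}|lebesgue. y (x, t) * sin (\<mu> * x)) * f t)"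
    using lebesgue_Fubini_snd(2)[OF F] unfolding inner
    by (simp add: set_lebesgue_integral_def F_def[abs_def])
qed

section \<open>The cosine coupling\<close>

text \<open>Rotating \<open>(w, w')\<close> by the angle \<open>x\<close> turns \<open>w'' = - w\<close> into the statement that the two quantities
  \<open>U\<close> and \<open>V\<close> are constant. The boundary value at 0 eliminates the cosine, and the normalization makes
  the remaining coefficient nonzero.\<close>

lemma first_dirichlet_eigenfunction:
  assumes "normalized_dirichlet_eigenfunction 1 w"
  obtains c where "c \<noteq> 0" "\<And>x. x \<in> {0..pi} \<Longrightarrow> w x = c * sin x"
proof -
  obtain w' where cont: "continuous_on {0..pi} w" and w0: "w 0 = 0"
    and "\<forall>x\<in>{0<..<pi}. (w has_real_derivative w' x) (at x) \<and> (w' has_real_derivative - 1 * w x) (at x)"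
    and norm: "L2_norm {0<..<pi} w = 1"
    using assms unfolding normalized_dirichlet_eigenfunction_def by blast
  then have w': "(w has_real_derivative w' x) (at x)" "(w' has_real_derivative - w x) (at x)"
    if "x \<in> {0<..<pi}" for x using that by auto
  define U where "U x = w x * sin x + w' x * cos x" for x
  define V where "V x = w x * cos x - w' x * sin x" for x
  have "(U has_real_derivative 0) (at x)" "(V has_real_derivative 0) (at x)" if "x \<in> {0<..<pi}" for x
    unfolding U_def V_def using w'[OF that] by (auto intro!: derivative_eq_intros)
  then have UV: "U x = U (pi/2)" "V x = V (pi/2)" if "x \<in> {0<..<pi}" for x
    using that by (intro DERIV_isconst3[of 0 pi]; simp)+
  define c d where "c = U (pi/2)" and "d = V (pi/2)"
  have wx: "w x - (c * sin x + d * cos x) = 0" if "x \<in> {0<..<pi}" for x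
  proof -
    have "c * sin x + d * cos x = U x * sin x + V x * cos x" using UV[OF that] by (simp add: c_def d_def)
    also have "\<dots> = w x * (cos x * cos x + sin x * sin x)"
      unfolding U_def V_def by algebra
    finally show ?thesis by (simp add: sin_cos_squared_add3)
  qed
  have wx': "w x - (c * sin x + d * cos x) = 0" if "x \<in> {0..pi}" for x
    by (rule continuous_constant_on_closure[of "{0<..<pi}" _ 0])
      (use wx that in \<open>auto intro!: continuous_intros cont\<close>)
  from wx'[of 0] w0 have "d = 0" by simp
  then have w: "w x = c * sin x" if "x \<in> {0..pi}" for x
    using wx'[OF that] by simp
  have "c \<noteq> 0"
  proof
    assume "c = 0"
    then have "(LINT x:{0<..<pi}|lebesgue. (w x)\<^sup>2) = (LINT x:{0<..<pi}|lebesgue. 0)"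
      by (intro set_lebesgue_integral_cong) (auto simp: w)
    with norm show False by (simp add: L2_norm_def)
  qed
  with w that show ?thesis by blast
qed

lemma sin_orthogonality:
  fixes m :: int
  shows "(LINT x:{0<..<pi}|lebesgue. sin x * sin (of_int m * x)) = (if m = 1 then pi / 2 else if m = -1 then - pi / 2 else 0)"
proof -
  have one: "(LINT x:{0<..<pi}|lebesgue. sin x * sin x) = pi / 2"
  proof (subst interval_integral_FTC_lebesgue[where F="\<lambda>x. x / 2 - sin (2 * x) / 4"])
    show "((\<lambda>x. x / 2 - sin (2 * x) / 4) has_real_derivative sin x * sin x) (at x)" for x :: real
    proof -
      have "1 / 2 - cos (2 * x) * 2 / 4 = sin x * sin x"
        using cos_double_sin[of x] unfolding power2_eq_square by linarith
      moreover have "((\<lambda>x. x / 2 - sin (2 * x) / 4) has_real_derivative 1 / 2 - cos (2 * x) * 2 / 4) (at x)"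
        by (auto intro!: derivative_eq_intros)
      ultimately show ?thesis by simp
    qed
  qed (auto intro!: continuous_intros)
  have other: "(LINT x:{0<..<pi}|lebesgue. sin x * sin (of_int m * x)) = 0" if "m \<noteq> 1" "m \<noteq> -1"
  proof -
    define p q :: real where "p = of_int (m - 1)" and "q = of_int (m + 1)"
    have pq: "p \<noteq> 0" "q \<noteq> 0" using that unfolding p_def q_def by simp_all
    have "sin (p * pi) = 0" "sin (q * pi) = 0"
      unfolding p_def q_def by (simp_all only: mult.commute[of _ pi] sin_npi_int)
    moreover have "(LINT x:{0<..<pi}|lebesgue. sin x * sin (of_int m * x)) =
      (sin (p * pi) / (2 * p) - sin (q * pi) / (2 * q)) - (sin (p * 0) / (2 * p) - sin (q * 0) / (2 * q))"
    proof (rule interval_integral_FTC_lebesgue)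
      fix x :: real
      have "p * x = of_int m * x - x" "q * x = of_int m * x + x" by (simp_all add: p_def q_def algebra_simps)
      then have "cos (p * x) / 2 - cos (q * x) / 2 = sin x * sin (of_int m * x)"
        by (simp only: cos_diff cos_add) (simp add: field_simps)
      moreover have "((\<lambda>x. sin (p * x) / (2 * p) - sin (q * x) / (2 * q)) has_real_derivative
          (cos (p * x) * p / (2 * p) - cos (q * x) * q / (2 * q))) (at x)"
        using pq by (auto intro!: derivative_eq_intros)
      ultimately show "((\<lambda>x. sin (p * x) / (2 * p) - sin (q * x) / (2 * q)) has_real_derivative
          sin x * sin (of_int m * x)) (at x)" using pq by simp
    qed (auto intro!: continuous_intros)
    ultimately show ?thesis by simp
  qed
  show ?thesis
    using one other by (auto simp: set_lebesgue_integral_def)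
qed

definition cosine_coupling :: "real \<Rightarrow> real" where
  "cosine_coupling x = (\<Sum>j. 1 / (real (Suc j))\<^sup>2 * cos (15 * real (Suc j) * x))"

lemma summable_inverse_squares_Suc: "summable (\<lambda>j. 1 / (real (Suc j))\<^sup>2)"
  using summable_Suc_iff[of "\<lambda>j. 1 / (real j)\<^sup>2"] inverse_power_summable[of 2, where 'a=real]
  by (simp add: inverse_eq_divide)

lemma cosine_coupling_partial_sums_uniform_limit:
  "uniform_limit UNIV (\<lambda>N x. \<Sum>j<N. 1 / (real (Suc j))\<^sup>2 * cos (15 * real (Suc j) * x)) cosine_coupling sequentially"
  unfolding cosine_coupling_def
  by (rule Weierstrass_m_test[OF _ summable_inverse_squares_Suc]) (simp add: abs_mult mult_left_le divide_right_mono)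

lemma continuous_cosine_coupling: "continuous_on UNIV cosine_coupling"
  by (rule uniform_limit_theorem[OF _ cosine_coupling_partial_sums_uniform_limit])
    (auto intro!: always_eventually continuous_intros)

text \<open>Since \<open>2 cos (15 j x) sin (l x) = sin ((l + 15 j) x) + sin ((l - 15 j) x)\<close>, the coupling links mode
  \<open>l\<close> only to modes whose signed index is congruent to \<open>l\<close> modulo 15. The partial sums of the coupling are bounded
  uniformly, so the series may be integrated term by term.\<close>

lemma coupling_integral_sums:
  fixes l :: int
  assumes f: "set_integrable lebesgue (QT T) f"
    and Zc: "\<And>m::int. Zc m = (LINT p:QT T|lebesgue. f p * sin (of_int m * fst p))"
  shows "(\<lambda>j. (Zc (l + 15 * int (Suc j)) + Zc (l - 15 * int (Suc j))) / (2 * (real (Suc j))\<^sup>2)) sums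
     (LINT p:QT T|lebesgue. cosine_coupling (fst p) * (f p * sin (of_int l * fst p)))"
proof -
  define A where "A N x = (\<Sum>j<N. 1 / (real (Suc j))\<^sup>2 * cos (15 * real (Suc j) * x))" for N :: nat and x :: real
  define B where "B = (\<Sum>j. 1 / (real (Suc j))\<^sup>2)"
  define F where "F p = indicator (QT T) p *\<^sub>R f p" for p
  have Fi: "integrable lebesgue F" using f unfolding F_def[abs_def] set_integrable_def .
  have AB: "\<bar>A N x\<bar> \<le> B" for N x
  proof -
    have "\<bar>A N x\<bar> \<le> (\<Sum>j<N. \<bar>1 / (real (Suc j))\<^sup>2 * cos (15 * real (Suc j) * x)\<bar>)"
      unfolding A_def by (rule sum_abs)
    also have "\<dots> \<le> (\<Sum>j<N. 1 / (real (Suc j))\<^sup>2)"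
      by (intro sum_mono) (simp add: abs_mult mult_left_le divide_right_mono)
    also have "\<dots> \<le> B"
      unfolding B_def by (intro sum_le_suminf summable_inverse_squares_Suc) auto
    finally show ?thesis .
  qed
  have Fg: "integrable lebesgue (\<lambda>p. F p * g (fst p))"
    if g: "continuous_on UNIV g" "\<And>x. \<bar>g x\<bar> \<le> C" for g :: "real \<Rightarrow> real" and C
  proof (rule Bochner_Integration.integrable_bound[of _ "\<lambda>p. C * F p"])
    have "continuous_on UNIV (\<lambda>p::real \<times> real. g (fst p))"
      by (intro continuous_on_compose2[OF g(1)] continuous_intros) auto
    then have "(\<lambda>p::real \<times> real. g (fst p)) \<in> borel_measurable lebesgue"
      by (intro measurable_completion) (auto intro: borel_measurable_continuous_onI)
    then show "(\<lambda>p. F p * g (fst p)) \<in> borel_measurable lebesgue"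
      using borel_measurable_integrable[OF Fi] by (intro borel_measurable_times)
    have "\<bar>F p\<bar> * \<bar>g (fst p)\<bar> \<le> \<bar>C\<bar> * \<bar>F p\<bar>" for p
      using mult_left_mono[of "\<bar>g (fst p)\<bar>" "\<bar>C\<bar>" "\<bar>F p\<bar>"] g(2)[of "fst p"] by (simp add: mult.commute)
    then show "AE p in lebesgue. norm (F p * g (fst p)) \<le> norm (C * F p)" by (simp add: abs_mult)
  qed (use Fi in simp)
  have Zc': "Zc m = (LINT p|lebesgue. F p * sin (of_int m * fst p))" for m
    by (simp add: Zc F_def set_lebesgue_integral_def mult.assoc)
  have sins: "integrable lebesgue (\<lambda>p. F p * sin (of_int m * fst p))" for m
    by (rule Fg[where C=1]) (auto intro!: continuous_intros)
  have prod: "1 / (real (Suc j))\<^sup>2 * cos (15 * real (Suc j) * x) * sin (of_int l * x) =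
     (sin (of_int (l + 15 * int (Suc j)) * x) + sin (of_int (l - 15 * int (Suc j)) * x)) / (2 * (real (Suc j))\<^sup>2)" for j x
  proof -
    have "of_int (l + 15 * int (Suc j)) * x = of_int l * x + 15 * real (Suc j) * x"
      "of_int (l - 15 * int (Suc j)) * x = of_int l * x - 15 * real (Suc j) * x"
      by (simp_all add: algebra_simps)
    then show ?thesis by (simp only: sin_add sin_diff) (simp add: mult_ac)
  qed
  have partial: "(LINT p|lebesgue. F p * (A N (fst p) * sin (of_int l * fst p))) =
      (\<Sum>j<N. (Zc (l + 15 * int (Suc j)) + Zc (l - 15 * int (Suc j))) / (2 * (real (Suc j))\<^sup>2))" for N
  proof -
    have "(LINT p|lebesgue. F p * (A N (fst p) * sin (of_int l * fst p))) =
       (LINT p|lebesgue. (\<Sum>j<N. (F p * sin (of_int (l + 15 * int (Suc j)) * fst p) +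
          F p * sin (of_int (l - 15 * int (Suc j)) * fst p)) / (2 * (real (Suc j))\<^sup>2)))"
      unfolding A_def sum_distrib_right prod sum_distrib_left
      by (simp only: times_divide_eq_right distrib_left)
    also have "\<dots> = (\<Sum>j<N. LINT p|lebesgue. (F p * sin (of_int (l + 15 * int (Suc j)) * fst p) +
          F p * sin (of_int (l - 15 * int (Suc j)) * fst p)) / (2 * (real (Suc j))\<^sup>2))"
      using sins by (intro Bochner_Integration.integral_sum integrable_divide Bochner_Integration.integrable_add)
    also have "\<dots> = (\<Sum>j<N. (Zc (l + 15 * int (Suc j)) + Zc (l - 15 * int (Suc j))) / (2 * (real (Suc j))\<^sup>2))"
      using sins by (simp only: integral_divide_zero Bochner_Integration.integral_add Zc')
    finally show ?thesis .
  qed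
  have "(\<lambda>N. LINT p|lebesgue. F p * (A N (fst p) * sin (of_int l * fst p))) \<longlonglongrightarrow>
     (LINT p|lebesgue. F p * (cosine_coupling (fst p) * sin (of_int l * fst p)))"
  proof (rule integral_dominated_convergence[where w="\<lambda>p. B * \<bar>F p\<bar>"])
    have cA: "continuous_on UNIV (A N)" for N unfolding A_def by (intro continuous_intros)
    have ABs: "\<bar>A N x * sin (of_int l * x)\<bar> \<le> B" for N x
      using mult_mono[OF AB[of N x] abs_sin_le_one[of "of_int l * x"]] AB[of N x] by (simp add: abs_mult)
    show "(\<lambda>p. F p * (A N (fst p) * sin (of_int l * fst p))) \<in> borel_measurable lebesgue" for N
      by (intro borel_measurable_integrable Fg[of "\<lambda>x. A N x * sin (of_int l * x)", OF _ ABs] continuous_intros cA)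
    have lim: "(\<lambda>N. A N x) \<longlonglongrightarrow> cosine_coupling x" for x
      using tendsto_uniform_limitI[OF cosine_coupling_partial_sums_uniform_limit, of x] by (simp add: A_def)
    show "AE p in lebesgue. (\<lambda>N. F p * (A N (fst p) * sin (of_int l * fst p))) \<longlonglongrightarrow>
        F p * (cosine_coupling (fst p) * sin (of_int l * fst p))"
      by (intro AE_I2 tendsto_intros lim)
    show "AE p in lebesgue. norm (F p * (A N (fst p) * sin (of_int l * fst p))) \<le> B * \<bar>F p\<bar>" for N
    proof (rule AE_I2)
      fix p :: "real \<times> real"
      have "norm (F p * (A N (fst p) * sin (of_int l * fst p))) = \<bar>A N (fst p) * sin (of_int l * fst p)\<bar> * \<bar>F p\<bar>"
        by (simp add: abs_mult)
      also have "\<dots> \<le> B * \<bar>F p\<bar>" by (intro mult_right_mono ABs) simp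
      finally show "norm (F p * (A N (fst p) * sin (of_int l * fst p))) \<le> B * \<bar>F p\<bar>" .
    qed
    have "\<bar>cosine_coupling x * sin (of_int l * x)\<bar> \<le> B" for x
      by (rule tendsto_upperbound[OF tendsto_rabs[OF tendsto_mult[OF lim tendsto_const]]]) (use ABs in auto)
    then show "(\<lambda>p. F p * (cosine_coupling (fst p) * sin (of_int l * fst p))) \<in> borel_measurable lebesgue"
      by (intro borel_measurable_integrable Fg[of "\<lambda>x. cosine_coupling x * sin (of_int l * x)" B]
          continuous_intros continuous_cosine_coupling)
  qed (use Fi in simp)
  then have "(\<lambda>j. (Zc (l + 15 * int (Suc j)) + Zc (l - 15 * int (Suc j))) / (2 * (real (Suc j))\<^sup>2)) sums
     (LINT p|lebesgue. F p * (cosine_coupling (fst p) * sin (of_int l * fst p)))"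
    unfolding sums_def partial .
  then show ?thesis
    by (simp add: F_def set_lebesgue_integral_def mult_ac)
qed

text \<open>With a multiple of \<open>sin x\<close> as initial datum, \<open>z\<close> has only the first mode. Mode \<open>l\<close> of the coupling
  sees it through those \<open>j\<close> for which one of \<open>l + 15 j\<close>, \<open>l - 15 j\<close> is 1 or -1: there is none
  if 15 divides \<open>l\<close>, and exactly \<open>j = k\<close> if \<open>l = 15 k + 1\<close>.\<close>

lemma coupling_integral_eq:
  fixes l :: int
  assumes sol: "transposition_solution T \<alpha> (\<lambda>u. 0) (Hm1_of w) v y z Y Z" and T: "T > 0"
    and w: "\<And>x. x \<in> {0..pi} \<Longrightarrow> w x = c * sin x"
    and \<theta>: "continuous_on UNIV \<theta>"
  shows "(\<exists>i. l = 15 * i) \<Longrightarrow>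
      (LINT p:QT T|lebesgue. z p * (cosine_coupling (fst p) * (\<theta> (snd p) * sin (of_int l * fst p)))) = 0"
    and "l = 15 * int k + 1 \<Longrightarrow> k \<ge> 1 \<Longrightarrow>
      (LINT p:QT T|lebesgue. z p * (cosine_coupling (fst p) * (\<theta> (snd p) * sin (of_int l * fst p)))) =
      c * pi / (4 * (real k)\<^sup>2) * (LINT t:{0<..<T}|lebesgue. \<theta> t * exp (- t))"
proof -
  define Zc where "Zc m = (LINT p:QT T|lebesgue. z p * \<theta> (snd p) * sin (of_int m * fst p))" for m :: int
  have wm: "(LINT x:{0<..<pi}|lebesgue. w x * sin (of_int m * x)) = c * (LINT x:{0<..<pi}|lebesgue. sin x * sin (of_int m * x))" for m :: int
  proof -
    have "(LINT x:{0<..<pi}|lebesgue. w x * sin (of_int m * x)) = (LINT x:{0<..<pi}|lebesgue. c * (sin x * sin (of_int m * x)))"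
      by (rule set_lebesgue_integral_cong) (auto simp: w)
    then show ?thesis by simp
  qed
  have Zc: "Zc m = c * (LINT x:{0<..<pi}|lebesgue. sin x * sin (of_int m * x)) *
     (LINT t:{0<..<T}|lebesgue. \<theta> t * exp (- ((real_of_int m)\<^sup>2 * t)))" for m
    using transposition_solution_z_coefficient[OF sol T \<theta>, of m] by (simp add: Zc_def wm mult.assoc)
  have Zc1: "Zc 1 = c * pi / 2 * (LINT t:{0<..<T}|lebesgue. \<theta> t * exp (- t))"
    unfolding Zc sin_orthogonality by simp
  have Zc0: "Zc m = 0" if "m \<noteq> 1" "m \<noteq> -1" for m
    unfolding Zc sin_orthogonality using that by simp
  have "z \<in> L2 (QT T)"
    using sol unfolding transposition_solution_def L2_C0_Hm1_def by blast
  moreover have "continuous_on UNIV (\<lambda>p::real \<times> real. \<theta> (snd p))"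
    by (intro continuous_on_compose2[OF \<theta>] continuous_intros) auto
  ultimately have "set_integrable lebesgue (QT T) (\<lambda>p. z p * \<theta> (snd p))"
    by (intro L2_times_continuous_integrable open_QT bounded_QT)
  then have sums: "(\<lambda>j. (Zc (l + 15 * int (Suc j)) + Zc (l - 15 * int (Suc j))) / (2 * (real (Suc j))\<^sup>2)) sums
     (LINT p:QT T|lebesgue. z p * (cosine_coupling (fst p) * (\<theta> (snd p) * sin (of_int l * fst p))))"
    using coupling_integral_sums[of T "\<lambda>p. z p * \<theta> (snd p)" Zc l] by (simp add: Zc_def mult_ac)
  show "(LINT p:QT T|lebesgue. z p * (cosine_coupling (fst p) * (\<theta> (snd p) * sin (of_int l * fst p)))) = 0"
    if "\<exists>i. l = 15 * i"
  proof -
    from that obtain i where i: "l = 15 * i" by blast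
    have "Zc (l + 15 * int (Suc j)) = 0" "Zc (l - 15 * int (Suc j)) = 0" for j
      unfolding i by (rule Zc0; presburger)+
    with sums have "(\<lambda>j. 0) sums (LINT p:QT T|lebesgue. z p * (cosine_coupling (fst p) * (\<theta> (snd p) * sin (of_int l * fst p))))"
      by simp
    then show ?thesis using sums_unique2 sums_zero by blast
  qed
  show "(LINT p:QT T|lebesgue. z p * (cosine_coupling (fst p) * (\<theta> (snd p) * sin (of_int l * fst p)))) =
      c * pi / (4 * (real k)\<^sup>2) * (LINT t:{0<..<T}|lebesgue. \<theta> t * exp (- t))"
    if l: "l = 15 * int k + 1" and k: "k \<ge> 1"
  proof -
    have "(\<lambda>j. (Zc (l + 15 * int (Suc j)) + Zc (l - 15 * int (Suc j))) / (2 * (real (Suc j))\<^sup>2)) =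
       (\<lambda>j. if j = k - 1 then Zc 1 / (2 * (real (Suc j))\<^sup>2) else 0)"
    proof
      fix j
      have "Zc (l + 15 * int (Suc j)) = 0"
        unfolding l by (rule Zc0; presburger)
      moreover have "Zc (l - 15 * int (Suc j)) = (if j = k - 1 then Zc 1 else 0)"
      proof (cases "j = k - 1")
        case True
        then have "l - 15 * int (Suc j) = 1" using k l by (simp add: of_nat_diff)
        then show ?thesis unfolding \<open>l - 15 * int (Suc j) = 1\<close> using True by simp
      next
        case False
        then have "l - 15 * int (Suc j) \<noteq> 1" "l - 15 * int (Suc j) \<noteq> -1" using k l by presburger+
        then show ?thesis using False Zc0 by simp
      qed
      ultimately show "(Zc (l + 15 * int (Suc j)) + Zc (l - 15 * int (Suc j))) / (2 * (real (Suc j))\<^sup>2) =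
         (if j = k - 1 then Zc 1 / (2 * (real (Suc j))\<^sup>2) else 0)" by simp
    qed
    with sums have "(\<lambda>j. if j = k - 1 then Zc 1 / (2 * (real (Suc j))\<^sup>2) else 0) sums
      (LINT p:QT T|lebesgue. z p * (cosine_coupling (fst p) * (\<theta> (snd p) * sin (of_int l * fst p))))" by simp
    moreover have "(\<lambda>j. if j = k - 1 then Zc 1 / (2 * (real (Suc j))\<^sup>2) else 0) sums (Zc 1 / (2 * (real (Suc (k - 1)))\<^sup>2))"
      by (rule sums_single)
    ultimately show ?thesis
      using k Zc1 by (auto dest: sums_unique2)
  qed
qed

section \<open>Passage to the final time\<close>

lemma sine_weak_deriv:
  shows "(\<lambda>x. c * (\<mu> * cos (\<mu> * x))) \<in> L2 {0<..<pi}"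
    and "weak_deriv {0<..<pi} 1 (\<lambda>x. c * sin (\<mu> * x)) (\<lambda>x. c * (\<mu> * cos (\<mu> * x)))"
proof -
  have cont: "continuous_on UNIV (\<lambda>x. c * (\<mu> * cos (\<mu> * x)))" by (intro continuous_intros)
  then show "(\<lambda>x. c * (\<mu> * cos (\<mu> * x))) \<in> L2 {0<..<pi}" by (intro continuous_in_L2) auto
  have "((\<lambda>x. c * sin (\<mu> * x)) has_derivative (\<lambda>h. c * (\<mu> * cos (\<mu> * x)) * h)) (at x)" for x
    unfolding has_field_derivative_def[symmetric] by (auto intro!: derivative_eq_intros)
  from weak_deriv_if_classical[OF this, of 1 "{0<..<pi}"] cont
  show "weak_deriv {0<..<pi} 1 (\<lambda>x. c * sin (\<mu> * x)) (\<lambda>x. c * (\<mu> * cos (\<mu> * x)))" by simp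
qed

lemma scaled_sine_in_H10:
  assumes "sin (\<mu> * pi) = 0"
  shows "(\<lambda>x. c * sin (\<mu> * x)) \<in> H10"
  unfolding H10_def using assms sine_weak_deriv[of c \<mu>] by (auto intro!: continuous_intros)

lemma sine_in_H10_unit_ball:
  assumes "sin (\<mu> * pi) = 0"
  obtains K where "K > 0" "(\<lambda>x. 1 / K * sin (\<mu> * x)) \<in> H10_unit_ball"
proof -
  define g where "g x = \<mu> * cos (\<mu> * x)" for x
  define K where "K = L2_norm {0<..<pi} g + 1"
  have "L2_norm {0<..<pi} g \<ge> 0"
    unfolding L2_norm_def set_lebesgue_integral_def
    by (intro real_sqrt_ge_zero Bochner_Integration.integral_nonneg) (auto simp: indicator_def)
  then have K: "K > 0" "L2_norm {0<..<pi} g \<le> K" by (auto simp: K_def)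
  have "L2_norm {0<..<pi} (\<lambda>x. 1 / K * (\<mu> * cos (\<mu> * x))) = L2_norm {0<..<pi} g / K"
    unfolding L2_norm_def g_def using K by (simp add: power_divide real_sqrt_divide)
  then have "L2_norm {0<..<pi} (\<lambda>x. 1 / K * (\<mu> * cos (\<mu> * x))) \<le> 1" using K by simp
  then have "(\<lambda>x. 1 / K * sin (\<mu> * x)) \<in> H10_unit_ball"
    using scaled_sine_in_H10[OF assms, of "1 / K"] sine_weak_deriv[of "1 / K" \<mu>]
    unfolding H10_unit_ball_def by blast
  with K that show ?thesis by blast
qed

lemma abs_le_Hm1_norm_diff:
  assumes "l \<in> Hm1" "l' \<in> Hm1" "u \<in> H10_unit_ball"
  shows "\<bar>l u - l' u\<bar> \<le> Hm1_norm (\<lambda>u. l u - l' u)"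
proof -
  obtain C C' where "\<forall>u\<in>H10_unit_ball. \<bar>l u\<bar> \<le> C" "\<forall>u\<in>H10_unit_ball. \<bar>l' u\<bar> \<le> C'"
    using assms unfolding Hm1_def by blast
  then have "bdd_above ((\<lambda>u. \<bar>l u - l' u\<bar>) ` H10_unit_ball)"
    by (intro bdd_aboveI2[of _ _ "C + C'"]) (smt (verit))
  then show ?thesis
    unfolding Hm1_norm_def using assms(3) by (rule cSUP_upper[rotated])
qed

lemma Hm1_continuous_sine_tendsto:
  assumes y: "L2_C0_Hm1 T y Y" and "T > 0" and \<mu>: "sin (\<mu> * pi) = 0"
  shows "((\<lambda>t. Y t (\<lambda>x. sin (\<mu> * x))) \<longlongrightarrow> Y T (\<lambda>x. sin (\<mu> * x))) (at T within {0..T})"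
proof -
  obtain K where K: "K > 0" "(\<lambda>x. 1 / K * sin (\<mu> * x)) \<in> H10_unit_ball"
    using sine_in_H10_unit_ball[OF \<mu>] .
  define u where "u = (\<lambda>x. 1 / K * sin (\<mu> * x))"
  have u: "u \<in> H10_unit_ball" "u \<in> H10" using K by (auto simp: u_def H10_unit_ball_def)
  have Ku: "(\<lambda>x. sin (\<mu> * x)) = (\<lambda>x. K * u x)" using K by (simp add: u_def)
  have Hm1: "Y t \<in> Hm1" if "t \<in> {0..T}" for t using y that by (auto simp: L2_C0_Hm1_def)
  have scale: "Y t (\<lambda>x. sin (\<mu> * x)) = K * Y t u" if "t \<in> {0..T}" for t
    using Hm1[OF that] u(2) unfolding Ku Hm1_def by blast
  have T: "T \<in> {0..T}" using \<open>T > 0\<close> by simp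
  have "((\<lambda>t. Hm1_norm (\<lambda>u. Y t u - Y T u)) \<longlongrightarrow> 0) (at T within {0..T})"
    using y T by (auto simp: L2_C0_Hm1_def)
  then have "((\<lambda>t. Y t u - Y T u) \<longlongrightarrow> 0) (at T within {0..T})"
    by (rule Lim_null_comparison[rotated])
      (auto simp: eventually_at_filter intro!: always_eventually abs_le_Hm1_norm_diff Hm1 T u)
  then have "((\<lambda>t. Y t u) \<longlongrightarrow> Y T u) (at T within {0..T})" by (simp add: LIM_zero_iff)
  then have "((\<lambda>t. K * Y t u) \<longlongrightarrow> K * Y T u) (at T within {0..T})" by (intro tendsto_intros)
  then show ?thesis
    unfolding scale[OF T]
    by (rule Lim_transform_eventually) (auto simp: eventually_at_filter scale)
qed

text \<open>The kernels \<open>(n + 1) t ^ n / T ^ (n + 1)\<close> have mass 1 on \<open>(0, T)\<close> and concentrate at \<open>T\<close>. This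
  is how a function that is known almost everywhere is evaluated at the final time.\<close>

lemma terminal_concentration:
  fixes h H E :: "real \<Rightarrow> real"
  assumes T: "T > 0" and h: "set_integrable lebesgue {0<..<T} h"
    and hH: "AE t in lebesgue. t \<in> {0<..<T} \<longrightarrow> h t = H t"
    and H: "(H \<longlongrightarrow> 0) (at T within {0..T})"
    and E: "continuous_on UNIV E" "\<And>t. t \<in> {0<..<T} \<Longrightarrow> \<bar>E t\<bar> \<le> 1"
  shows "(\<lambda>n. LINT t:{0<..<T}|lebesgue. h t * (E t * (real (Suc n) * t ^ n / T ^ Suc n))) \<longlonglongrightarrow> 0"
proof (rule LIMSEQ_I)
  fix r :: real assume "r > 0"
  define \<epsilon> where "\<epsilon> = r / 3"
  have "\<epsilon> > 0" using \<open>r > 0\<close> by (simp add: \<epsilon>_def)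
  then have "eventually (\<lambda>t. \<bar>H t\<bar> < \<epsilon>) (at T within {0..T})"
    using H by (auto dest: order_tendstoD tendsto_rabs_zero)
  then obtain d where d: "d > 0" "\<And>t. t \<in> {0..T} \<Longrightarrow> t \<noteq> T \<Longrightarrow> dist t T < d \<Longrightarrow> \<bar>H t\<bar> < \<epsilon>"
    unfolding eventually_at by auto
  \<comment> \<open>on \<open>(s, T)\<close> the function is small, on \<open>(0, s]\<close> the kernel is\<close>
  define s where "s = max (T / 2) (T - d)"
  have s: "0 < s" "s < T" using T d(1) by (auto simp: s_def)
  define q where "q = s / T"
  have q: "0 < q" "q < 1" using s T by (auto simp: q_def)
  define k where "k n t = real (Suc n) * t ^ n / T ^ Suc n" for n t
  define C where "C = (LINT t:{0<..<T}|lebesgue. \<bar>h t\<bar>)"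
  have C: "C \<ge> 0"
    unfolding C_def set_lebesgue_integral_def
    by (intro Bochner_Integration.integral_nonneg) (auto simp: indicator_def)
  have ck: "continuous_on UNIV (k n)" for n
    unfolding k_def using T by (intro continuous_intros) auto
  have k0: "k n t \<ge> 0" if "t \<ge> 0" for n t using that T by (simp add: k_def)
  have ki: "(LINT t:{0<..<T}|lebesgue. k n t) = 1" for n
  proof -
    have "((\<lambda>t. t ^ Suc n / T ^ Suc n) has_real_derivative k n t) (at t)" for t
      unfolding k_def using T by (auto intro!: derivative_eq_intros simp del: power_Suc)
    from interval_integral_FTC_lebesgue[OF _ this ck, of 0 T] T show ?thesis by simp
  qed
  have small: "k n t \<le> real (Suc n) * q ^ n / T" if "0 < t" "t \<le> s" for n t
  proof -
    have "t ^ n \<le> s ^ n" using that by (intro power_mono) auto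
    then have "k n t \<le> real (Suc n) * s ^ n / T ^ Suc n"
      unfolding k_def using T by (intro divide_right_mono mult_left_mono) auto
    also have "\<dots> = real (Suc n) * q ^ n / T" using T by (simp add: q_def power_divide)
    finally show ?thesis .
  qed
  have bound: "AE t in lebesgue. t \<in> {0<..<T} \<longrightarrow>
      \<bar>h t * (E t * k n t)\<bar> \<le> \<epsilon> * k n t + real (Suc n) * q ^ n / T * \<bar>h t\<bar>" for n
    using hH
  proof eventually_elim
    case (elim t)
    show ?case
    proof
      assume t: "t \<in> {0<..<T}"
      have "\<bar>h t * (E t * k n t)\<bar> = \<bar>h t\<bar> * k n t * \<bar>E t\<bar>"
        using k0[of t n] t by (simp add: abs_mult)
      also have "\<dots> \<le> \<bar>h t\<bar> * k n t"
        using E(2)[OF t] k0[of t n] t by (intro mult_left_le) auto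
      also have "\<dots> \<le> \<epsilon> * k n t + real (Suc n) * q ^ n / T * \<bar>h t\<bar>"
      proof (cases "t \<le> s")
        case True
        have "\<bar>h t\<bar> * k n t \<le> \<bar>h t\<bar> * (real (Suc n) * q ^ n / T)"
          using small[of t n] True t by (intro mult_left_mono) auto
        moreover have "0 \<le> \<epsilon> * k n t" using \<open>\<epsilon> > 0\<close> k0[of t n] t by simp
        ultimately show ?thesis by (simp add: mult.commute)
      next
        case False
        then have "\<bar>H t\<bar> < \<epsilon>" using t by (intro d(2)) (auto simp: s_def dist_real_def)
        then have "\<bar>h t\<bar> * k n t \<le> \<epsilon> * k n t"
          using elim t k0[of t n] by (intro mult_right_mono) auto
        moreover have "0 \<le> real (Suc n) * q ^ n / T * \<bar>h t\<bar>" using q T by simp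
        ultimately show ?thesis by linarith
      qed
      finally show "\<bar>h t * (E t * k n t)\<bar> \<le> \<epsilon> * k n t + real (Suc n) * q ^ n / T * \<bar>h t\<bar>" .
    qed
  qed
  have kint: "set_integrable lebesgue {0<..<T} (\<lambda>t. \<epsilon> * k n t)" for n
    by (intro set_integrable_mult_right set_integrable_continuous ck) auto
  have hint: "set_integrable lebesgue {0<..<T} (\<lambda>t. c * \<bar>h t\<bar>)" for c
    using h by (intro set_integrable_mult_right set_integrable_abs)
  have le: "\<bar>LINT t:{0<..<T}|lebesgue. h t * (E t * k n t)\<bar> \<le> \<epsilon> + real (Suc n) * q ^ n / T * C" for n
  proof -
    have m: "set_borel_measurable lebesgue {0<..<T} (\<lambda>t. h t * (E t * k n t))"
    proof -
      have "(\<lambda>t. indicator {0<..<T} t *\<^sub>R h t) \<in> borel_measurable lebesgue"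
        using h by (auto simp: set_integrable_def)
      moreover have "(\<lambda>t. E t * k n t) \<in> borel_measurable lebesgue"
        by (intro measurable_completion) (auto intro!: borel_measurable_continuous_onI continuous_intros E ck)
      ultimately have "(\<lambda>t. (indicator {0<..<T} t *\<^sub>R h t) * (E t * k n t)) \<in> borel_measurable lebesgue"
        by (rule borel_measurable_times)
      then show ?thesis by (simp add: set_borel_measurable_def mult.assoc)
    qed
    have i: "set_integrable lebesgue {0<..<T} (\<lambda>t. h t * (E t * k n t))"
    proof (rule set_integrable_bound[OF set_integral_add(1)[OF kint[of n] hint[of "real (Suc n) * q ^ n / T"]] m])
      show "AE t in lebesgue. t \<in> {0<..<T} \<longrightarrow> norm (h t * (E t * k n t)) \<le>
          norm (\<epsilon> * k n t + real (Suc n) * q ^ n / T * \<bar>h t\<bar>)"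
        using bound[of n] by eventually_elim auto
    qed
    have "\<bar>LINT t:{0<..<T}|lebesgue. h t * (E t * k n t)\<bar> \<le> (LINT t:{0<..<T}|lebesgue. \<bar>h t * (E t * k n t)\<bar>)"
      using integral_abs_bound[of lebesgue "\<lambda>t. indicator {0<..<T} t *\<^sub>R (h t * (E t * k n t))"]
      by (simp add: set_lebesgue_integral_def abs_mult)
    also have "\<dots> \<le> (LINT t:{0<..<T}|lebesgue. \<epsilon> * k n t + real (Suc n) * q ^ n / T * \<bar>h t\<bar>)"
      using i kint[of n] hint bound[of n]
      by (intro set_integral_mono_AE set_integrable_abs set_integral_add(1))
    also have "\<dots> = \<epsilon> + real (Suc n) * q ^ n / T * C"
      using kint[of n] hint by (subst set_integral_add(2)) (simp_all add: ki C_def)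
    finally show ?thesis .
  qed
  have qn: "(\<lambda>n. real n * q ^ n) \<longlonglongrightarrow> 0" using q by (intro powser_times_n_limit_0) auto
  have q0: "(\<lambda>n. q ^ n) \<longlonglongrightarrow> 0" using q by (intro LIMSEQ_power_zero) auto
  have "(\<lambda>n. (real n * q ^ n + q ^ n) / T * C) \<longlonglongrightarrow> (0 + 0) / T * C"
    by (intro tendsto_mult tendsto_divide tendsto_add qn q0 tendsto_const) (use T in auto)
  then have "eventually (\<lambda>n. (real n * q ^ n + q ^ n) / T * C < \<epsilon>) sequentially"
    using \<open>\<epsilon> > 0\<close> by (auto dest: order_tendstoD(2))
  then obtain N where N: "\<And>n. n \<ge> N \<Longrightarrow> real (Suc n) * q ^ n / T * C < \<epsilon>"
    unfolding eventually_sequentially by (auto simp: algebra_simps)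
  show "\<exists>N. \<forall>n\<ge>N. norm ((LINT t:{0<..<T}|lebesgue. h t * (E t * (real (Suc n) * t ^ n / T ^ Suc n))) - 0) < r"
  proof (intro exI allI impI)
    fix n assume "N \<le> n"
    have "\<bar>LINT t:{0<..<T}|lebesgue. h t * (E t * k n t)\<bar> < r"
      using N[OF \<open>N \<le> n\<close>] le[of n] \<open>r > 0\<close> unfolding \<epsilon>_def by linarith
    then show "norm ((LINT t:{0<..<T}|lebesgue. h t * (E t * (real (Suc n) * t ^ n / T ^ Suc n))) - 0) < r"
      unfolding k_def real_norm_def diff_0_right .
  qed
qed

lemma cutoff_tendsto:
  fixes T b :: real
  assumes T: "T > 0" and b: "b \<ge> 0" and g: "set_integrable lebesgue {0<..<T} g"
  shows "(\<lambda>n. LINT t:{0<..<T}|lebesgue. g t * (exp (- (b * (T - t))) * (1 - t ^ Suc n / T ^ Suc n)))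
     \<longlonglongrightarrow> (LINT t:{0<..<T}|lebesgue. g t * exp (- (b * (T - t))))"
proof -
  define G where "G t = indicator {0<..<T} t *\<^sub>R g t" for t :: real
  have G: "integrable lebesgue G" using g unfolding G_def[abs_def] set_integrable_def .
  have meas: "(\<lambda>t::real. G t * f t) \<in> borel_measurable lebesgue" if "continuous_on UNIV f" for f :: "real \<Rightarrow> real"
    using borel_measurable_integrable[OF G] measurable_completion[of f lborel borel]
      borel_measurable_continuous_onI[OF that]
    by (intro borel_measurable_times) auto
  have "(\<lambda>n. LINT t|lebesgue. G t * (exp (- (b * (T - t))) * (1 - (t / T) ^ Suc n)))
     \<longlonglongrightarrow> (LINT t|lebesgue. G t * exp (- (b * (T - t))))"
  proof (rule integral_dominated_convergence[where w="\<lambda>t. \<bar>G t\<bar>"])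
    show "AE t in lebesgue. (\<lambda>n. G t * (exp (- (b * (T - t))) * (1 - (t / T) ^ Suc n))) \<longlonglongrightarrow> G t * exp (- (b * (T - t)))"
    proof (rule AE_I2)
      fix t
      show "(\<lambda>n. G t * (exp (- (b * (T - t))) * (1 - (t / T) ^ Suc n))) \<longlonglongrightarrow> G t * exp (- (b * (T - t)))"
      proof (cases "t \<in> {0<..<T}")
        case True
        then have "(\<lambda>n. (t / T) ^ n) \<longlonglongrightarrow> 0" by (intro LIMSEQ_power_zero) auto
        then have "(\<lambda>n. (t / T) ^ Suc n) \<longlonglongrightarrow> 0" by (rule LIMSEQ_Suc)
        then have "(\<lambda>n. G t * (exp (- (b * (T - t))) * (1 - (t / T) ^ Suc n))) \<longlonglongrightarrow> G t * (exp (- (b * (T - t))) * (1 - 0))"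
          by (intro tendsto_mult tendsto_diff tendsto_const)
        then show ?thesis by simp
      qed (simp add: G_def)
    qed
    show "AE t in lebesgue. norm (G t * (exp (- (b * (T - t))) * (1 - (t / T) ^ Suc n))) \<le> \<bar>G t\<bar>" for n
    proof (rule AE_I2)
      fix t
      show "norm (G t * (exp (- (b * (T - t))) * (1 - (t / T) ^ Suc n))) \<le> \<bar>G t\<bar>"
      proof (cases "t \<in> {0<..<T}")
        case True
        then have "0 \<le> (t / T) ^ Suc n" "(t / T) ^ Suc n \<le> 1" by (auto intro!: power_le_one simp del: power_Suc)
        then have "\<bar>1 - (t / T) ^ Suc n\<bar> \<le> 1" by simp
        moreover have "exp (- (b * (T - t))) \<le> 1" using True b by simp
        ultimately have "exp (- (b * (T - t))) * \<bar>1 - (t / T) ^ Suc n\<bar> \<le> 1 * 1" by (intro mult_mono) auto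
        then show ?thesis by (simp add: abs_mult mult_left_le del: power_Suc)
      qed (simp add: G_def)
    qed
  qed (use G T in \<open>auto intro!: meas continuous_intros\<close>)
  then show ?thesis
    by (simp add: G_def set_lebesgue_integral_def power_divide mult.assoc)
qed

text \<open>If \<open>y(T) = 0\<close>, then Duhamel's formula for the \<open>l\<close>-th coefficient of \<open>y\<close> expresses an exponential
  moment of the control. The adjoint state would be \<open>exp (- l\<^sup>2 (T - t)) sin (l x)\<close>, but test states must
  vanish at \<open>T\<close>. The factor \<open>1 - (t / T) ^ (n + 1)\<close> enforces this; its derivative yields the kernel of
  the concentration lemma, so the contribution of \<open>y\<close> tends to the coefficient of \<open>y(T)\<close>.\<close>

lemma moment_identity_if_null_at_T:
  fixes l :: int
  assumes sol: "transposition_solution T \<alpha> (\<lambda>u. 0) (Hm1_of w) v y z Y Z" and T: "T > 0"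
    and \<alpha>: "\<And>x. x \<in> {0<..<pi} \<Longrightarrow> \<alpha> x = cosine_coupling x"
    and v: "v \<in> L2 {0<..<T}"
    and null: "\<And>u. u \<in> H10 \<Longrightarrow> Y T u = 0"
    and K: "\<And>\<theta>. continuous_on UNIV \<theta> \<Longrightarrow>
      (LINT p:QT T|lebesgue. z p * (cosine_coupling (fst p) * (\<theta> (snd p) * sin (of_int l * fst p)))) =
      K * (LINT t:{0<..<T}|lebesgue. \<theta> t * exp (- t))"
  shows "of_int l * (LINT t:{0<..<T}|lebesgue. v t * exp (- ((of_int l)\<^sup>2 * (T - t)))) =
    - K * (LINT t:{0<..<T}|lebesgue. exp (- t) * exp (- ((of_int l)\<^sup>2 * (T - t))))"
proof -
  define \<mu> :: real where "\<mu> = of_int l"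
  have \<mu>: "sin (\<mu> * pi) = 0" unfolding \<mu>_def by (simp only: mult.commute[of _ pi] sin_npi_int)
  define E where "E t = exp (- (\<mu>\<^sup>2 * (T - t)))" for t
  define k where "k n t = real (Suc n) * t ^ n / T ^ Suc n" for n t
  define \<theta> where "\<theta> n t = E t * (1 - t ^ Suc n / T ^ Suc n)" for n t
  define h where "h t = (LINT x:{0<..<pi}|lebesgue. y (x, t) * sin (\<mu> * x))" for t
  have yC: "L2_C0_Hm1 T y Y" using sol by (simp add: transposition_solution_def)
  then have y: "y \<in> L2 (QT T)" by (simp add: L2_C0_Hm1_def)
  have cE: "continuous_on UNIV E" unfolding E_def by (intro continuous_intros)
  have ck: "continuous_on UNIV (k n)" for n unfolding k_def using T by (intro continuous_intros) auto
  have c\<theta>: "continuous_on UNIV (\<theta> n)" for n unfolding \<theta>_def using T by (intro continuous_intros cE) auto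
  have D\<theta>: "(\<theta> n has_real_derivative \<mu>\<^sup>2 * \<theta> n t - E t * k n t) (at t)" for n t
  proof -
    have "(E has_real_derivative \<mu>\<^sup>2 * E t) (at t)"
      unfolding E_def by (auto intro!: derivative_eq_intros)
    moreover have "((\<lambda>t. 1 - t ^ Suc n / T ^ Suc n) has_real_derivative - k n t) (at t)"
      unfolding k_def using T by (auto intro!: derivative_eq_intros simp del: power_Suc)
    ultimately show ?thesis
      unfolding \<theta>_def by (rule DERIV_cong[OF DERIV_mult]) (simp add: algebra_simps del: power_Suc)
  qed
  have eq: "(LINT t:{0<..<T}|lebesgue. h t * (E t * k n t)) =
     K * (LINT t:{0<..<T}|lebesgue. \<theta> n t * exp (- t)) + \<mu> * (LINT t:{0<..<T}|lebesgue. v t * \<theta> n t)" for n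
  proof -
    have "(LINT t:{0<..<T}|lebesgue. h t * (E t * k n t)) = (LINT p:QT T|lebesgue. y p * ((E (snd p) * k n (snd p)) * sin (\<mu> * fst p)))"
      using sine_coefficient_Fubini(2)[OF y, of "\<lambda>t. E t * k n t" \<mu>] cE ck
      by (simp add: h_def continuous_intros)
    also have "\<dots> = (LINT p:QT T|lebesgue. y p * (((of_int l)\<^sup>2 * \<theta> n (snd p) - (\<mu>\<^sup>2 * \<theta> n (snd p) - E (snd p) * k n (snd p))) * sin (of_int l * fst p)))"
      by (simp add: \<mu>_def)
    also have "\<dots> = (LINT p:QT T|lebesgue. z p * (cosine_coupling (fst p) * (\<theta> n (snd p) * sin (of_int l * fst p)))) +
        of_int l * (LINT t:{0<..<T}|lebesgue. v t * \<theta> n t)"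
      using T by (intro transposition_solution_y_coefficient[OF sol T \<alpha> continuous_cosine_coupling D\<theta>]
          continuous_intros c\<theta> cE ck) (auto simp: \<theta>_def)
    finally show ?thesis using K[OF c\<theta>] by (simp add: \<mu>_def)
  qed
  have hi: "set_integrable lebesgue {0<..<T} h"
    using sine_coefficient_Fubini(1)[OF y, of "\<lambda>_. 1" \<mu>] by (simp add: h_def[abs_def] continuous_intros)
  have sH: "(\<lambda>x. sin (\<mu> * x)) \<in> H10" using scaled_sine_in_H10[OF \<mu>, of 1] by simp
  have "AE t in lebesgue. t \<in> {0<..<T} \<longrightarrow> h t = Y t (\<lambda>x. sin (\<mu> * x))"
    using yC[unfolded L2_C0_Hm1_def] sH by (auto simp: h_def Hm1_of_def elim!: eventually_mono)
  moreover have "((\<lambda>t. Y t (\<lambda>x. sin (\<mu> * x))) \<longlongrightarrow> 0) (at T within {0..T})"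
    using Hm1_continuous_sine_tendsto[OF yC T \<mu>] null[OF sH] by simp
  moreover have "\<bar>E t\<bar> \<le> 1" if "t \<in> {0<..<T}" for t
    using that by (simp add: E_def)
  ultimately have "(\<lambda>n. LINT t:{0<..<T}|lebesgue. h t * (E t * k n t)) \<longlonglongrightarrow> 0"
    unfolding k_def by (rule terminal_concentration[OF T hi _ _ cE])
  moreover have "(\<lambda>n. K * (LINT t:{0<..<T}|lebesgue. \<theta> n t * exp (- t)) + \<mu> * (LINT t:{0<..<T}|lebesgue. v t * \<theta> n t)) \<longlonglongrightarrow>
     K * (LINT t:{0<..<T}|lebesgue. exp (- t) * E t) + \<mu> * (LINT t:{0<..<T}|lebesgue. v t * E t)"
  proof (intro tendsto_add tendsto_mult tendsto_const)
    have "set_integrable lebesgue {0<..<T} (\<lambda>t. exp (- t))"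
      by (intro set_integrable_continuous continuous_intros) auto
    from cutoff_tendsto[OF T _ this, of "\<mu>\<^sup>2"]
    show "(\<lambda>n. LINT t:{0<..<T}|lebesgue. \<theta> n t * exp (- t)) \<longlonglongrightarrow> (LINT t:{0<..<T}|lebesgue. exp (- t) * E t)"
      by (simp add: \<theta>_def E_def mult.commute del: power_Suc)
    have "set_integrable lebesgue {0<..<T} v"
      using L2_times_continuous_integrable[OF v, of "\<lambda>_. 1"] by (simp add: continuous_intros)
    from cutoff_tendsto[OF T _ this, of "\<mu>\<^sup>2"]
    show "(\<lambda>n. LINT t:{0<..<T}|lebesgue. v t * \<theta> n t) \<longlonglongrightarrow> (LINT t:{0<..<T}|lebesgue. v t * E t)"
      by (simp add: \<theta>_def E_def del: power_Suc)
  qed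
  ultimately have "K * (LINT t:{0<..<T}|lebesgue. exp (- t) * E t) + \<mu> * (LINT t:{0<..<T}|lebesgue. v t * E t) = 0"
    unfolding eq using LIMSEQ_unique by blast
  then show ?thesis by (simp add: E_def \<mu>_def)
qed

section \<open>Failure of null controllability of the first component\<close>

theorem theorem5p1:
  fixes T :: real and \<alpha> :: "real \<Rightarrow> real" and w :: "nat \<Rightarrow> real \<Rightarrow> real"
  assumes "T > 0"
    and "\<And>x. x \<in> {0<..<pi} \<Longrightarrow>
           \<alpha> x = (\<Sum>j. 1 / (real (Suc j))\<^sup>2 * cos (15 * real (Suc j) * x))"
    and "\<And>k. k \<ge> 1 \<Longrightarrow> normalized_dirichlet_eigenfunction ((real k)\<^sup>2) (w k)"
  shows "\<exists>k1\<in>{1..7::nat}. \<forall>v\<in>L2 {0<..<T}. \<forall>y z Y Z.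
           transposition_solution T \<alpha> (\<lambda>u. 0) (Hm1_of (w k1)) v y z Y Z \<longrightarrow>
           (\<exists>u\<in>H10. Y T u \<noteq> 0)"
proof (intro bexI[of _ 1] ballI allI impI)
  fix v y z Y Z
  assume v: "v \<in> L2 {0<..<T}" and sol: "transposition_solution T \<alpha> (\<lambda>u. 0) (Hm1_of (w 1)) v y z Y Z"
  obtain c where c: "c \<noteq> 0" "\<And>x. x \<in> {0..pi} \<Longrightarrow> w 1 x = c * sin x"
    using first_dirichlet_eigenfunction[of "w 1"] assms(3)[of 1] by auto
  have \<alpha>: "\<And>x. x \<in> {0<..<pi} \<Longrightarrow> \<alpha> x = cosine_coupling x"
    using assms(2) by (simp add: cosine_coupling_def)
  define V where "V = (LINT t:{0<..<T}|lebesgue. (v t)\<^sup>2)"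
  define M where "M b = (LINT t:{0<..<T}|lebesgue. v t * exp (- (b * (T - t))))" for b
  show "\<exists>u\<in>H10. Y T u \<noteq> 0"
  proof (rule ccontr)
    assume "\<not> (\<exists>u\<in>H10. Y T u \<noteq> 0)"
    then have null: "\<And>u. u \<in> H10 \<Longrightarrow> Y T u = 0" by blast
    note moment = moment_identity_if_null_at_T[OF sol assms(1) \<alpha> v null]
    have "M ((15 * real i)\<^sup>2) = 0" if "i \<ge> 1" for i
    proof -
      have "(LINT p:QT T|lebesgue. z p * (cosine_coupling (fst p) * (\<theta> (snd p) * sin (of_int (15 * int i) * fst p)))) =
          0 * (LINT t:{0<..<T}|lebesgue. \<theta> t * exp (- t))" if "continuous_on UNIV \<theta>" for \<theta>
        using coupling_integral_eq(1)[OF sol assms(1) c(2) that, of "15 * int i"] by simp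
      from moment[OF _ _ this] have "real_of_int (15 * int i) * M ((real_of_int (15 * int i))\<^sup>2) = 0"
        unfolding M_def by simp
      then have "15 * real i * M ((15 * real i)\<^sup>2) = 0" by simp
      then show ?thesis using that by simp
    qed
    then have upper: "\<bar>M ((30 * real n + 1)\<^sup>2)\<bar> \<le> (3 / 5) ^ n * (V + 1)" for n
      using assms(1) unfolding M_def V_def by (intro moments_decay_geometrically v) auto
    \<comment> \<open>the moment is at least \<open>D / n ^ 5\<close>: of the five powers, two come from the coupling coefficient, one from the boundary derivative, two from the time integral\<close>
    define D where "D = \<bar>c\<bar> * pi / 16 * (exp (- T) * (1 - exp (- T))) / 31 ^ 3"
    have "D > 0" unfolding D_def using c(1) assms(1) by simp
    have lower: "D \<le> real n ^ 5 * \<bar>M ((30 * real n + 1)\<^sup>2)\<bar>" if n: "n \<ge> 1" for n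
    proof -
      define l where "l = 30 * real n + 1"
      define J where "J = (LINT t:{0<..<T}|lebesgue. exp (- t) * exp (- (l\<^sup>2 * (T - t))))"
      have l: "1 \<le> l" "l \<le> 31 * real n" using n by (auto simp: l_def)
      have li: "of_int (15 * int (2 * n) + 1) = l" by (simp add: l_def)
      have "l * M (l\<^sup>2) = - (c * pi / (16 * (real n)\<^sup>2)) * J"
        using moment[of "15 * int (2 * n) + 1" "c * pi / (4 * (real (2 * n))\<^sup>2)"]
          coupling_integral_eq(2)[OF sol assms(1) c(2), where k="2 * n" and l="15 * int (2 * n) + 1"] n
        unfolding li M_def J_def by (simp add: power_mult_distrib)
      then have "\<bar>l * M (l\<^sup>2)\<bar> = \<bar>c\<bar> * pi / (16 * (real n)\<^sup>2) * \<bar>J\<bar>"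
        by (simp add: abs_mult)
      then have lM: "l * \<bar>M (l\<^sup>2)\<bar> = \<bar>c\<bar> * pi / (16 * (real n)\<^sup>2) * \<bar>J\<bar>"
        using l(1) by (simp add: abs_mult)
      have J: "exp (- T) * (1 - exp (- T)) / l\<^sup>2 \<le> J"
        unfolding J_def using l by (intro weighted_exponential_integral_ge assms one_le_power)
      have "D * 31 ^ 3 = \<bar>c\<bar> * pi / 16 * (exp (- T) * (1 - exp (- T)))" by (simp add: D_def)
      also have "\<dots> \<le> \<bar>c\<bar> * pi / 16 * (\<bar>J\<bar> * l\<^sup>2)"
      proof (rule mult_left_mono)
        have "exp (- T) * (1 - exp (- T)) \<le> J * l\<^sup>2" using J l(1) by (simp add: pos_divide_le_eq)
        also have "\<dots> \<le> \<bar>J\<bar> * l\<^sup>2" by (intro mult_right_mono) auto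
        finally show "exp (- T) * (1 - exp (- T)) \<le> \<bar>J\<bar> * l\<^sup>2" .
      qed simp
      also have "\<dots> = (\<bar>c\<bar> * pi / (16 * (real n)\<^sup>2) * \<bar>J\<bar>) * ((real n)\<^sup>2 * l\<^sup>2)"
        using n by simp
      also have "\<dots> = l ^ 3 * ((real n)\<^sup>2 * \<bar>M (l\<^sup>2)\<bar>)"
        unfolding lM[symmetric] by (simp add: power2_eq_square power3_eq_cube)
      also have "\<dots> \<le> (31 * real n) ^ 3 * ((real n)\<^sup>2 * \<bar>M (l\<^sup>2)\<bar>)"
        using l by (intro mult_right_mono power_mono) auto
      also have "\<dots> = real n ^ 5 * \<bar>M (l\<^sup>2)\<bar> * 31 ^ 3"
        by (simp add: power_mult_distrib eval_nat_numeral)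
      finally show ?thesis by (simp add: l_def)
    qed
    have "D \<le> (real n * (19 / 20) ^ n) ^ 5 * (V + 1)" if "n \<ge> 1" for n
    proof -
      have V: "V \<ge> 0"
        unfolding V_def set_lebesgue_integral_def
        by (intro Bochner_Integration.integral_nonneg) (auto simp: indicator_def)
      \<comment> \<open>splitting the geometric factor over the five powers of \<open>n\<close>\<close>
      have "(3 / 5 :: real) ^ n \<le> ((19 / 20) ^ 5) ^ n" by (intro power_mono) (simp_all add: eval_nat_numeral)
      then have "\<bar>M ((30 * real n + 1)\<^sup>2)\<bar> \<le> ((19 / 20) ^ n) ^ 5 * (V + 1)"
        using upper[of n] V by (intro order_trans[OF upper] mult_right_mono) (simp_all add: power_mult[symmetric] mult.commute)
      then have "real n ^ 5 * \<bar>M ((30 * real n + 1)\<^sup>2)\<bar> \<le> real n ^ 5 * (((19 / 20) ^ n) ^ 5 * (V + 1))"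
        by (intro mult_left_mono) auto
      with lower[OF that] show ?thesis by (simp add: power_mult_distrib mult.assoc)
    qed
    moreover have "(\<lambda>n. (real n * (19 / 20) ^ n) ^ 5 * (V + 1)) \<longlonglongrightarrow> 0 ^ 5 * (V + 1)"
      by (intro tendsto_mult tendsto_power tendsto_const powser_times_n_limit_0) simp
    ultimately have "D \<le> 0 ^ 5 * (V + 1)"
      by (intro LIMSEQ_le_const) auto
    with \<open>D > 0\<close> show False by simp
  qed
qed simp

end
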